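(* Let $\mathcal{R}_1=(\mathcal{P}(\mathbb{N})/Fin,\Delta,\cap,\mathbf{1})$ and $\mathcal{R}_2=(\mathcal{P}(\mathbb{T})/I,\Delta,\cap,\mathbf{1})$ be the commutative rings described in the context. Then (1) in $\mathrm{ZFC}+\mathrm{CH}$, $\mathcal{R}_1$ is isomorphic to $\mathcal{R}_2$; (2) in $\mathrm{ZFC}+\mathrm{OCA}$, $\mathcal{R}_1$ is not isomorphic to $\mathcal{R}_2$.
   Context: $Fin$ is the ideal of finite subsets of $\mathbb{N}$ and $\mathcal{P}(\mathbb{N})/Fin$ is the quotient of $\mathcal{P}(\mathbb{N})$ by $A\approx B$ iff $A\Delta B$ is finite. $\mathbb{T}=\{l,r\}^\star$ with the prefix order $\sqsubseteq$; an antichain is a set of pairwise incomparable words; $I=\{B\subseteq\mathbb{T}: B\text{ has no infinite antichain}\}$ and $\mathcal{P}(\mathbb{T})/I$ is the quotient by $A\approx_I B$ iff $A\Delta B\in I$. In both quotients, $\Delta$ (symmetric difference) and $\cap$ are defined on representatives, and $\mathbf{1}$ is the class of the whole set ($\mathbb{N}$, resp. $\mathbb{T}$); these form commutative rings with addition $\Delta$, multiplication $\cap$, and unity $\mathbf{1}$. CH is the Continuum Hypothesis; OCA is the Open Coloring Axiom: if $X\subseteq\mathbb{R}$ and $[X]^2=K_0\cup K_1$ with $K_0$ open in $X\times X$, then either some uncountable $Y\subseteq X$ has $[Y]^2\subseteq K_0$, or $X$ is a countable union of sets $H_n$ with $[H_n]^2\subseteq K_1$. *)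

theory Defs
  imports "HOL-Analysis.Analysis" "HOL-Algebra.QuotRing"
    "HOL-Library.Sublist" "HOL-Library.Ramsey" "HOL-Library.Equipollence"
begin

section \<open>Quotients of power sets\<close>

definition set_ideal :: "'a set set \<Rightarrow> bool" where
  "set_ideal J \<longleftrightarrow> {} \<in> J \<and> (\<forall>A\<in>J. \<forall>B\<in>J. A \<union> B \<in> J) \<and> (\<forall>A\<in>J. \<forall>B. B \<subseteq> A \<longrightarrow> B \<in> J)"

definition eq_mod :: "'a set set \<Rightarrow> ('a set \<times> 'a set) set" where
  "eq_mod J = {(A, B). sym_diff A B \<in> J}"

definition set_class :: "'a set set \<Rightarrow> 'a set \<Rightarrow> 'a set set" where
  "set_class J A = eq_mod J `` {A}"

text \<open>
  The unions below are over all choices of representatives. If \<open>J\<close> is an ideal, all these choices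
  give the same class (see \<open>pow_quotient_mult\<close> and \<open>pow_quotient_add\<close>).
\<close>

definition pow_quotient :: "'a set set \<Rightarrow> 'a set set ring" where
  "pow_quotient J =
    \<lparr>carrier = UNIV // eq_mod J,
     monoid.mult = (\<lambda>X Y. \<Union>A\<in>X. \<Union>B\<in>Y. set_class J (A \<inter> B)),
     one = set_class J UNIV,
     zero = set_class J {},
     add = (\<lambda>X Y. \<Union>A\<in>X. \<Union>B\<in>Y. set_class J (sym_diff A B))\<rparr>"

context
  fixes J :: "'a set set"
  assumes J: "set_ideal J"
begin

lemma set_ideal_sub2: "C \<subseteq> A \<union> B \<Longrightarrow> A \<in> J \<Longrightarrow> B \<in> J \<Longrightarrow> C \<in> J"
  using J unfolding set_ideal_def by blast

lemma equiv_eq_mod: "equiv UNIV (eq_mod J)"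
proof (rule equivI)
  show "refl (eq_mod J)"
    using J by (auto simp: refl_on_def eq_mod_def set_ideal_def)
  show "sym (eq_mod J)"
    by (auto simp: sym_def eq_mod_def Un_commute)
  show "trans (eq_mod J)"
  proof (rule transI)
    fix A B C assume "(A, B) \<in> eq_mod J" "(B, C) \<in> eq_mod J"
    then have "sym_diff A B \<in> J" "sym_diff B C \<in> J"
      by (simp_all add: eq_mod_def)
    then have "sym_diff A C \<in> J"
      by (rule set_ideal_sub2[rotated]) auto
    then show "(A, C) \<in> eq_mod J"
      by (simp add: eq_mod_def)
  qed
qed simp

lemma set_class_eq_iff: "set_class J A = set_class J B \<longleftrightarrow> sym_diff A B \<in> J"
  unfolding set_class_def
  using eq_equiv_class_iff[OF equiv_eq_mod, of A B] by (simp add: eq_mod_def)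

lemma mem_set_class_iff: "B \<in> set_class J A \<longleftrightarrow> sym_diff A B \<in> J"
  by (simp add: set_class_def eq_mod_def)

lemma self_mem_set_class: "A \<in> set_class J A"
  using J by (simp add: mem_set_class_iff set_ideal_def)

lemma carrier_pow_quotient: "carrier (pow_quotient J) = range (set_class J)"
  by (auto simp: pow_quotient_def quotient_def set_class_def)

lemma pow_quotient_mult:
  "set_class J A \<otimes>\<^bsub>pow_quotient J\<^esub> set_class J B = set_class J (A \<inter> B)"
proof -
  have const: "set_class J (A' \<inter> B') = set_class J (A \<inter> B)"
    if "A' \<in> set_class J A" "B' \<in> set_class J B" for A' B'
  proof -
    have "sym_diff (A' \<inter> B') (A \<inter> B) \<in> J"
      by (rule set_ideal_sub2[of _ "sym_diff A A'" "sym_diff B B'"])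
        (use that in \<open>auto simp: mem_set_class_iff\<close>)
    then show ?thesis
      by (simp add: set_class_eq_iff)
  qed
  have inner: "(\<Union>B'\<in>set_class J B. set_class J (A' \<inter> B')) = set_class J (A \<inter> B)"
    if "A' \<in> set_class J A" for A'
    by (rule UN_constant_eq[OF self_mem_set_class]) (intro ballI const that)
  have "(\<Union>A'\<in>set_class J A. \<Union>B'\<in>set_class J B. set_class J (A' \<inter> B')) =
      set_class J (A \<inter> B)"
    by (rule UN_constant_eq[OF self_mem_set_class]) (intro ballI inner)
  then show ?thesis
    by (simp only: pow_quotient_def monoid.simps ring.simps)
qed

lemma pow_quotient_add:
  "set_class J A \<oplus>\<^bsub>pow_quotient J\<^esub> set_class J B = set_class J (sym_diff A B)"
proof -
  have const: "set_class J (sym_diff A' B') = set_class J (sym_diff A B)"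
    if "A' \<in> set_class J A" "B' \<in> set_class J B" for A' B'
  proof -
    have "sym_diff (sym_diff A' B') (sym_diff A B) \<in> J"
      by (rule set_ideal_sub2[of _ "sym_diff A A'" "sym_diff B B'"])
        (use that in \<open>auto simp: mem_set_class_iff\<close>)
    then show ?thesis
      by (simp add: set_class_eq_iff)
  qed
  have inner: "(\<Union>B'\<in>set_class J B. set_class J (sym_diff A' B')) = set_class J (sym_diff A B)"
    if "A' \<in> set_class J A" for A'
    by (rule UN_constant_eq[OF self_mem_set_class]) (intro ballI const that)
  have "(\<Union>A'\<in>set_class J A. \<Union>B'\<in>set_class J B. set_class J (sym_diff A' B')) =
      set_class J (sym_diff A B)"
    by (rule UN_constant_eq[OF self_mem_set_class]) (intro ballI inner)
  then show ?thesis
    by (simp only: pow_quotient_def monoid.simps ring.simps)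
qed

lemma pow_quotient_one: "\<one>\<^bsub>pow_quotient J\<^esub> = set_class J UNIV"
  and pow_quotient_zero: "\<zero>\<^bsub>pow_quotient J\<^esub> = set_class J {}"
  by (simp_all add: pow_quotient_def)

lemma cring_pow_quotient: "cring (pow_quotient J)"
proof -
  have assoc: "sym_diff (sym_diff A B) C = sym_diff A (sym_diff B C)" for A B C :: "'a set"
    by blast
  have comm: "sym_diff A B = sym_diff B A" for A B :: "'a set"
    by blast
  have distrib: "sym_diff A B \<inter> C = sym_diff (A \<inter> C) (B \<inter> C)" for A B C :: "'a set"
    by blast
  note ops = pow_quotient_mult pow_quotient_add pow_quotient_one pow_quotient_zero
  show ?thesis
  proof (rule cringI)
    show "abelian_group (pow_quotient J)"
    proof (rule abelian_groupI; unfold carrier_pow_quotient; (elim imageE)?; hypsubst?)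
      fix A B C
      show "set_class J A \<oplus>\<^bsub>pow_quotient J\<^esub> set_class J B \<in> range (set_class J)"
        by (simp only: ops rangeI)
      show "\<zero>\<^bsub>pow_quotient J\<^esub> \<in> range (set_class J)"
        by (simp only: ops rangeI)
      show "(set_class J A \<oplus>\<^bsub>pow_quotient J\<^esub> set_class J B) \<oplus>\<^bsub>pow_quotient J\<^esub> set_class J C =
          set_class J A \<oplus>\<^bsub>pow_quotient J\<^esub> (set_class J B \<oplus>\<^bsub>pow_quotient J\<^esub> set_class J C)"
        by (simp only: ops assoc)
      show "set_class J A \<oplus>\<^bsub>pow_quotient J\<^esub> set_class J B =
          set_class J B \<oplus>\<^bsub>pow_quotient J\<^esub> set_class J A"
        unfolding ops by (subst comm) (rule refl)
      show "\<zero>\<^bsub>pow_quotient J\<^esub> \<oplus>\<^bsub>pow_quotient J\<^esub> set_class J A = set_class J A"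
        by (simp add: ops)
      have "set_class J A \<oplus>\<^bsub>pow_quotient J\<^esub> set_class J A = \<zero>\<^bsub>pow_quotient J\<^esub>"
        by (simp add: ops)
      then show "\<exists>Y\<in>range (set_class J). Y \<oplus>\<^bsub>pow_quotient J\<^esub> set_class J A = \<zero>\<^bsub>pow_quotient J\<^esub>"
        by blast
    qed
    show "comm_monoid (pow_quotient J)"
      by (rule comm_monoidI; unfold carrier_pow_quotient; (elim imageE)?; hypsubst?;
          simp add: ops Int_ac)
    fix X Y Z
    assume "X \<in> carrier (pow_quotient J)" "Y \<in> carrier (pow_quotient J)"
      "Z \<in> carrier (pow_quotient J)"
    then obtain A B C where "X = set_class J A" "Y = set_class J B" "Z = set_class J C"
      unfolding carrier_pow_quotient by blast
    then show "(X \<oplus>\<^bsub>pow_quotient J\<^esub> Y) \<otimes>\<^bsub>pow_quotient J\<^esub> Z =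
        X \<otimes>\<^bsub>pow_quotient J\<^esub> Z \<oplus>\<^bsub>pow_quotient J\<^esub> Y \<otimes>\<^bsub>pow_quotient J\<^esub> Z"
      by (simp only: ops distrib)
  qed
qed

end

section \<open>The two rings\<close>

definition Fin :: "nat set set" where
  "Fin = {A. finite A}"

datatype letter = Left | Right

type_synonym word = "letter list"

definition antichain :: "word set \<Rightarrow> bool" where
  "antichain A \<longleftrightarrow> pairwise parallel A"

definition antichain_ideal :: "word set set" where
  "antichain_ideal = {B. \<not> (\<exists>A\<subseteq>B. infinite A \<and> antichain A)}"

definition R1 :: "nat set set ring" where
  "R1 = pow_quotient Fin"

definition R2 :: "word set set ring" where
  "R2 = pow_quotient antichain_ideal"

lemma set_ideal_Fin: "set_ideal Fin"
  by (auto simp: set_ideal_def Fin_def intro: finite_subset)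

lemma set_ideal_antichain_ideal: "set_ideal antichain_ideal"
proof -
  have "A \<union> B \<in> antichain_ideal" if "A \<in> antichain_ideal" "B \<in> antichain_ideal" for A B
  proof -
    have False if C: "C \<subseteq> A \<union> B" "infinite C" "antichain C" for C
    proof -
      have "antichain (C \<inter> A)" "antichain (C \<inter> B)"
        using C(3) by (auto simp: antichain_def pairwise_def)
      then have "finite (C \<inter> A)" "finite (C \<inter> B)"
        using \<open>A \<in> antichain_ideal\<close> \<open>B \<in> antichain_ideal\<close> by (auto simp: antichain_ideal_def)
      moreover have "C = (C \<inter> A) \<union> (C \<inter> B)"
        using C(1) by blast
      ultimately show False
        using C(2) by (metis finite_UnI)
    qed
    then show ?thesis
      by (auto simp: antichain_ideal_def)
  qed
  moreover have "{} \<in> antichain_ideal"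
    by (auto simp: antichain_ideal_def)
  moreover have "B \<in> antichain_ideal" if "A \<in> antichain_ideal" "B \<subseteq> A" for A B
    using that unfolding antichain_ideal_def by blast
  ultimately show ?thesis
    unfolding set_ideal_def by blast
qed

lemma cring_R1: "cring R1" and cring_R2: "cring R2"
  unfolding R1_def R2_def
  by (intro cring_pow_quotient set_ideal_Fin set_ideal_antichain_ideal)+

section \<open>The two set-theoretic axioms\<close>

definition CH :: bool where
  "CH \<longleftrightarrow> (\<forall>X::real set. uncountable X \<longrightarrow> X \<approx> (UNIV::real set))"

text \<open>
  A set \<open>K0\<close> of unordered pairs is open in \<open>X \<times> X\<close> if the symmetric set of ordered pairs that it
  induces is open in \<open>X \<times> X\<close>.
\<close>

definition OCA :: bool where
  "OCA \<longleftrightarrow> (\<forall>(X::real set) K0 K1.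
     nsets X 2 = K0 \<union> K1 \<longrightarrow>
     openin (top_of_set (X \<times> X)) {(x, y). {x, y} \<in> K0} \<longrightarrow>
       (\<exists>Y\<subseteq>X. uncountable Y \<and> nsets Y 2 \<subseteq> K0) \<or>
       (\<exists>H::nat \<Rightarrow> real set. X = (\<Union>n. H n) \<and> (\<forall>n. nsets (H n) 2 \<subseteq> K1)))"

end

theory Submission
  imports Defs
begin

text \<open>
  Part (1): both quotients are countably saturated atomless Boolean algebras. Countable families are
  separated modulo any ideal, so saturation only needs that positive sets split and that decreasing
  sequences of positive sets have a positive lower bound. Under CH a back-and-forth construction of
  length \<open>\<omega>\<^sub>1\<close> then gives an isomorphism.

  Part (2): let \<open>K\<^sub>n\<close> be the subtree above \<open>r\<^sup>n l\<close> and, for an infinite branch \<open>x\<close>, let \<open>C\<^sub>x\<close> be the union of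
  the copies of \<open>x\<close> in all \<open>K\<^sub>n\<close>. As \<open>C\<^sub>x \<inter> K\<^sub>n\<close> is a chain, an isomorphism to \<open>P(\<nat>)/Fin\<close> would turn \<open>C\<^sub>x\<close>
  into a set having finite intersection with every image of a \<open>K\<^sub>n\<close>, that is, into a function
  \<open>\<nat> \<rightarrow> \<nat>\<close>. OCA bounds uncountably many of these functions, modulo finite, by one function. Pulling
  the latter back gives a set \<open>D\<close> with every \<open>D \<inter> K\<^sub>n\<close> in the ideal, although some \<open>D \<inter> K\<^sub>n\<close> contains
  uncountably many branches.
\<close>

section \<open>Isomorphisms as relations between sets\<close>

text \<open>A partial isomorphism of the quotients, given on representatives so that no image has to
  be chosen. It may be multivalued on sets: the last clause, applied to symmetric differences, makes
  it well defined and injective modulo the ideals.\<close>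

definition bool_corr :: "'a set set \<Rightarrow> 'b set set \<Rightarrow> ('a set \<times> 'b set) set \<Rightarrow> bool" where
  "bool_corr J K R \<longleftrightarrow> (UNIV, UNIV) \<in> R \<and>
     (\<forall>A B A' B'. (A, B) \<in> R \<longrightarrow> (A', B') \<in> R \<longrightarrow> (A \<inter> A', B \<inter> B') \<in> R) \<and>
     (\<forall>A B. (A, B) \<in> R \<longrightarrow> (- A, - B) \<in> R) \<and>
     (\<forall>A B. (A, B) \<in> R \<longrightarrow> (A \<in> J \<longleftrightarrow> B \<in> K))"

lemma bool_corr_UNIV: "bool_corr J K R \<Longrightarrow> (UNIV, UNIV) \<in> R"
  unfolding bool_corr_def by blast

lemma bool_corr_Int:
  "bool_corr J K R \<Longrightarrow> (A, B) \<in> R \<Longrightarrow> (A', B') \<in> R \<Longrightarrow> (A \<inter> A', B \<inter> B') \<in> R"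
  unfolding bool_corr_def by blast

lemma bool_corr_Compl: "bool_corr J K R \<Longrightarrow> (A, B) \<in> R \<Longrightarrow> (- A, - B) \<in> R"
  unfolding bool_corr_def by blast

lemma bool_corr_ideal: "bool_corr J K R \<Longrightarrow> (A, B) \<in> R \<Longrightarrow> A \<in> J \<longleftrightarrow> B \<in> K"
  unfolding bool_corr_def by blast

lemma bool_corr_Un:
  assumes "bool_corr J K R" "(A, B) \<in> R" "(A', B') \<in> R"
  shows "(A \<union> A', B \<union> B') \<in> R"
  using bool_corr_Compl[OF assms(1) bool_corr_Int[OF assms(1)
      bool_corr_Compl[OF assms(1,2)] bool_corr_Compl[OF assms(1,3)]]] by simp

lemma bool_corr_Diff:
  assumes "bool_corr J K R" "(A, B) \<in> R" "(A', B') \<in> R"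
  shows "(A - A', B - B') \<in> R"
  using bool_corr_Int[OF assms(1,2) bool_corr_Compl[OF assms(1,3)]] by (simp add: Diff_eq)

lemma bool_corr_converse: "bool_corr J K R \<Longrightarrow> bool_corr K J (R\<inverse>)"
  by (simp add: bool_corr_def)

lemma ideal_mono: "set_ideal J \<Longrightarrow> A \<in> J \<Longrightarrow> B \<subseteq> A \<Longrightarrow> B \<in> J"
  unfolding set_ideal_def by blast

lemma ideal_Un: "set_ideal J \<Longrightarrow> A \<in> J \<Longrightarrow> B \<in> J \<Longrightarrow> A \<union> B \<in> J"
  unfolding set_ideal_def by blast

lemma ideal_Un_iff: "set_ideal J \<Longrightarrow> A \<union> B \<in> J \<longleftrightarrow> A \<in> J \<and> B \<in> J"
  using ideal_Un[of J A B] ideal_mono[of J "A \<union> B"] by blast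

lemma ideal_empty: "set_ideal J \<Longrightarrow> {} \<in> J"
  unfolding set_ideal_def by blast

lemma ideal_UN:
  assumes "set_ideal J" "finite I" "\<And>i. i \<in> I \<Longrightarrow> A i \<in> J"
  shows "(\<Union>i\<in>I. A i) \<in> J"
  using assms(2,3) by (induction rule: finite_induct) (simp_all add: ideal_empty ideal_Un assms(1))

text \<open>The relation is the lift of the graph of the isomorphism to sets. Complements are
  preserved because \<open>- A\<close> is the sum of \<open>UNIV\<close> and \<open>A\<close>, and
  membership in the ideal because it says that the class is zero.\<close>

lemma bool_corr_of_ring_iso:
  assumes J: "set_ideal J" and K: "set_ideal K" and iso: "pow_quotient J \<simeq> pow_quotient K"
  obtains R where "bool_corr J K R" "Domain R = UNIV" "Range R = UNIV"
proof -
  obtain h where h: "h \<in> ring_iso (pow_quotient J) (pow_quotient K)"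
    using iso by (auto simp: is_ring_iso_def)
  note car = carrier_pow_quotient[OF J] carrier_pow_quotient[OF K]
  have hbij: "bij_betw h (range (set_class J)) (range (set_class K))"
    using ring_iso_memE(5)[OF h] by (simp add: car)
  have hone: "h (set_class J UNIV) = set_class K UNIV"
    using ring_iso_memE(4)[OF h] by (simp add: pow_quotient_one[OF J] pow_quotient_one[OF K])
  have hInt: "h (set_class J (A \<inter> A')) = set_class K (B \<inter> B')"
    if "h (set_class J A) = set_class K B" "h (set_class J A') = set_class K B'" for A A' B B'
    using ring_iso_memE(2)[OF h, of "set_class J A" "set_class J A'"] that
    by (simp add: car pow_quotient_mult[OF J] pow_quotient_mult[OF K])
  have hadd: "h (set_class J (sym_diff A A')) = set_class K (sym_diff B B')"
    if "h (set_class J A) = set_class K B" "h (set_class J A') = set_class K B'" for A A' B B'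
    using ring_iso_memE(3)[OF h, of "set_class J A" "set_class J A'"] that
    by (simp add: car pow_quotient_add[OF J] pow_quotient_add[OF K])
  have hzero: "h (set_class J {}) = set_class K {}"
    using hadd[OF hone hone] by simp
  define R where "R = {(A, B). h (set_class J A) = set_class K B}"
  show thesis
  proof
    have "A \<in> J \<longleftrightarrow> B \<in> K" if AB: "h (set_class J A) = set_class K B" for A B
    proof -
      have "A \<in> J \<longleftrightarrow> set_class J A = set_class J {}"
        by (simp add: set_class_eq_iff[OF J])
      also have "\<dots> \<longleftrightarrow> h (set_class J A) = h (set_class J {})"
        using inj_on_eq_iff[OF bij_betw_imp_inj_on[OF hbij]] by simp
      also have "\<dots> \<longleftrightarrow> B \<in> K"
        by (simp add: hzero AB set_class_eq_iff[OF K])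
      finally show ?thesis .
    qed
    moreover have "h (set_class J (- A)) = set_class K (- B)"
      if "h (set_class J A) = set_class K B" for A B
      using hadd[OF hone that] by (simp add: Compl_eq_Diff_UNIV)
    ultimately show "bool_corr J K R"
      unfolding bool_corr_def R_def mem_Collect_eq prod.case using hInt hone by blast
    show "Domain R = UNIV"
    proof -
      have "\<exists>B. h (set_class J A) = set_class K B" for A
        using bij_betwE[OF hbij] by blast
      then show ?thesis
        by (auto simp: R_def)
    qed
    show "Range R = UNIV"
    proof -
      have "\<exists>A. h (set_class J A) = set_class K B" for B
      proof -
        have "set_class K B \<in> h ` range (set_class J)"
          by (simp only: bij_betw_imp_surj_on[OF hbij] rangeI)
        then show ?thesis
          by auto
      qed
      then show ?thesis
        by (auto simp: R_def)
    qed
  qed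
qed

text \<open>Symmetric differences of related pairs are related, so equality of classes transfers in
  both directions (\<open>eq\<close>). One direction makes the induced map independent of
  representatives, the other makes it injective.\<close>

lemma ring_iso_of_bool_corr:
  assumes J: "set_ideal J" and K: "set_ideal K"
    and R: "bool_corr J K R" and dom: "Domain R = UNIV" and ran: "Range R = UNIV"
  shows "pow_quotient J \<simeq> pow_quotient K"
proof -
  have sd: "(sym_diff A A', sym_diff B B') \<in> R" if "(A, B) \<in> R" "(A', B') \<in> R" for A A' B B'
    using that by (intro bool_corr_Un[OF R] bool_corr_Diff[OF R])
  have eq: "set_class J A = set_class J A' \<longleftrightarrow> set_class K B = set_class K B'"
    if "(A, B) \<in> R" "(A', B') \<in> R" for A A' B B'
    using bool_corr_ideal[OF R sd[OF that]] by (simp add: set_class_eq_iff[OF J] set_class_eq_iff[OF K])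
  define F where "F A = (SOME B. (A, B) \<in> R)" for A
  have F: "(A, F A) \<in> R" for A
  proof -
    have "A \<in> Domain R"
      using dom by simp
    then show ?thesis
      unfolding F_def by (auto intro: someI)
  qed
  define h where "h X = set_class K (F (SOME A. X = set_class J A))" for X
  have h: "h (set_class J A) = set_class K B" if "(A, B) \<in> R" for A B
  proof -
    have "set_class J A = set_class J (SOME A'. set_class J A = set_class J A')"
      by (rule someI) (rule refl)
    then show ?thesis
      unfolding h_def using eq[OF that F] by simp
  qed
  have "h \<in> ring_iso (pow_quotient J) (pow_quotient K)"
  proof (rule ring_iso_memI; (unfold carrier_pow_quotient[OF J] carrier_pow_quotient[OF K])?)
    show "h x \<in> range (set_class K)" for x
      by (simp add: h_def)
    show "h (x \<otimes>\<^bsub>pow_quotient J\<^esub> y) = h x \<otimes>\<^bsub>pow_quotient K\<^esub> h y"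
      if *: "x \<in> range (set_class J)" "y \<in> range (set_class J)" for x y
    proof -
      obtain A B where xy: "x = set_class J A" "y = set_class J B"
        using * by blast
      show ?thesis
        unfolding xy h[OF F, of A] h[OF F, of B] pow_quotient_mult[OF J] pow_quotient_mult[OF K]
        by (intro h bool_corr_Int[OF R] F)
    qed
    show "h (x \<oplus>\<^bsub>pow_quotient J\<^esub> y) = h x \<oplus>\<^bsub>pow_quotient K\<^esub> h y"
      if *: "x \<in> range (set_class J)" "y \<in> range (set_class J)" for x y
    proof -
      obtain A B where xy: "x = set_class J A" "y = set_class J B"
        using * by blast
      show ?thesis
        unfolding xy h[OF F, of A] h[OF F, of B] pow_quotient_add[OF J] pow_quotient_add[OF K]
        by (intro h sd F)
    qed
    show "h \<one>\<^bsub>pow_quotient J\<^esub> = \<one>\<^bsub>pow_quotient K\<^esub>"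
      by (simp add: pow_quotient_one[OF J] pow_quotient_one[OF K] h bool_corr_UNIV[OF R])
    show "bij_betw h (range (set_class J)) (range (set_class K))"
      unfolding bij_betw_def
    proof
      show "inj_on h (range (set_class J))"
        using eq[OF F F] by (auto simp: inj_on_def h[OF F])
      have "set_class K B \<in> h ` range (set_class J)" for B
      proof -
        obtain A where "(A, B) \<in> R"
          using ran by (auto simp: set_eq_iff)
        then show ?thesis
          by (intro image_eqI[where x="set_class J A"]) (simp_all add: h)
      qed
      then show "h ` range (set_class J) = range (set_class K)"
        by (auto simp: h_def)
    qed
  qed
  then show ?thesis
    by (auto simp: is_ring_iso_def)
qed

section \<open>Saturation\<close>

text \<open>In terms of the quotient algebra: it is nontrivial and atomless, and every decreasing
  sequence of nonzero elements has a nonzero lower bound. Sets outside \<open>J\<close> are called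
  positive below.\<close>

definition saturated_ideal :: "'a set set \<Rightarrow> bool" where
  "saturated_ideal J \<longleftrightarrow> set_ideal J \<and> UNIV \<notin> J \<and>
     (\<forall>A. A \<notin> J \<longrightarrow> (\<exists>B\<subseteq>A. B \<notin> J \<and> A - B \<notin> J)) \<and>
     (\<forall>B::nat \<Rightarrow> 'a set. decseq B \<longrightarrow> (\<forall>n. B n \<notin> J) \<longrightarrow> (\<exists>C. C \<notin> J \<and> (\<forall>n. C - B n \<in> J)))"

text \<open>Intersecting a lower bound with \<open>B 0\<close> removes only a set of the ideal, so
  this one inclusion can be made exact.\<close>

lemma saturated_ideal_lower_bound:
  assumes sat: "saturated_ideal J" and B: "decseq B" "\<And>n::nat. B n \<notin> J"
  obtains C where "C \<subseteq> B 0" "C \<notin> J" "\<And>n. C - B n \<in> J"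
proof -
  have J: "set_ideal J"
    using sat by (simp add: saturated_ideal_def)
  obtain C where C: "C \<notin> J" "\<And>n. C - B n \<in> J"
    using sat B unfolding saturated_ideal_def by blast
  show thesis
  proof
    show "C \<inter> B 0 \<notin> J"
    proof
      assume "C \<inter> B 0 \<in> J"
      from ideal_Un[OF J this C(2)[of 0]] show False
        using C(1) by (simp add: Un_Diff_Int Un_commute)
    qed
    show "C \<inter> B 0 - B n \<in> J" for n
      by (rule ideal_mono[OF J C(2)[of n]]) auto
  qed simp
qed

text \<open>A positive subset of \<open>E n\<close> is halved repeatedly. At step \<open>k\<close>
  the half to keep is one whose removal leaves \<open>E k\<close> positive; one of the two
  qualifies, since \<open>E k\<close> is the union of its differences with two disjoint sets. A
  lower bound of the kept halves works for all \<open>k\<close> at once.\<close>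

lemma thin_subset:
  assumes sat: "saturated_ideal J" and E: "\<And>k::nat. E k \<notin> J"
  obtains q where "q \<subseteq> E n" "q \<notin> J" "\<And>k. E k - q \<notin> J"
proof -
  have J: "set_ideal J"
    using sat by (simp add: saturated_ideal_def)
  have "\<exists>c. \<forall>k. (c k \<notin> J \<and> c k \<subseteq> E n) \<and> (c (Suc k) \<subseteq> c k \<and> E k - c (Suc k) \<notin> J)"
  proof (rule dependent_nat_choice)
    show "\<exists>x. x \<notin> J \<and> x \<subseteq> E n"
      using E by blast
    fix x k assume x: "x \<notin> J \<and> x \<subseteq> E n"
    then obtain y where y: "y \<subseteq> x" "y \<notin> J" "x - y \<notin> J"
      using sat unfolding saturated_ideal_def by metis
    show "\<exists>z. (z \<notin> J \<and> z \<subseteq> E n) \<and> (z \<subseteq> x \<and> E k - z \<notin> J)"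
    proof (cases "E k - y \<in> J")
      case False
      with x y show ?thesis by blast
    next
      case True
      have "E k - (x - y) \<notin> J"
      proof
        assume "E k - (x - y) \<in> J"
        from ideal_Un[OF J True this] have "E k \<in> J"
          by (rule ideal_mono[OF J]) auto
        with E show False by blast
      qed
      with x y show ?thesis by blast
    qed
  qed
  then obtain c where c: "\<And>k. c k \<notin> J" "\<And>k. c k \<subseteq> E n" "\<And>k. c (Suc k) \<subseteq> c k"
    "\<And>k. E k - c (Suc k) \<notin> J"
    by blast
  have "decseq c"
    using c(3) by (rule decseq_SucI)
  then obtain q where q: "q \<subseteq> c 0" "q \<notin> J" "\<And>k. q - c k \<in> J"
    using saturated_ideal_lower_bound[OF sat] c(1) by blast
  show thesis
  proof
    show "q \<subseteq> E n" "q \<notin> J"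
      using q c(2) by blast+
    fix k show "E k - q \<notin> J"
    proof
      assume "E k - q \<in> J"
      from ideal_Un[OF J this q(3)[of "Suc k"]] have "E k - c (Suc k) \<in> J"
        by (rule ideal_mono[OF J]) auto
      with c(4) show False by blast
    qed
  qed
qed

text \<open>\<open>M n\<close> is the union of the pieces chosen so far. The invariant is that every
  \<open>E k\<close> stays positive outside it, which holds because each new piece is thin.\<close>

lemma disjoint_refinement_nat:
  assumes sat: "saturated_ideal J" and E: "\<And>k::nat. E k \<notin> J"
  obtains F where "\<And>k. F k \<subseteq> E k" "\<And>k. F k \<notin> J" "disjoint_family F"
proof -
  have "\<exists>M. \<forall>n. (\<forall>k. E k - M n \<notin> J) \<and>
      (M n \<subseteq> M (Suc n) \<and> M (Suc n) - M n \<subseteq> E n \<and> M (Suc n) - M n \<notin> J)"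
  proof (rule dependent_nat_choice)
    show "\<exists>x. \<forall>k. E k - x \<notin> J"
      using E by (intro exI[of _ "{}"]) auto
    fix x n assume "\<forall>k. E k - x \<notin> J"
    then obtain q where q: "q \<subseteq> E n - x" "q \<notin> J" "\<And>k. E k - x - q \<notin> J"
      using thin_subset[OF sat, of "\<lambda>k. E k - x" n] by blast
    have "(x \<union> q) - x = q"
      using q(1) by blast
    with q show "\<exists>y. (\<forall>k. E k - y \<notin> J) \<and> (x \<subseteq> y \<and> y - x \<subseteq> E n \<and> y - x \<notin> J)"
      by (intro exI[of _ "x \<union> q"]) (auto simp: Diff_eq Int_assoc)
  qed
  then obtain M where M: "\<And>n. M n \<subseteq> M (Suc n)" "\<And>n. M (Suc n) - M n \<subseteq> E n"
    "\<And>n. M (Suc n) - M n \<notin> J"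
    by blast
  have "disjoint_family (\<lambda>n. M (Suc n) - M n)"
    using M(1) by (rule disjoint_family_Suc)
  with M(2,3) show thesis
    by (rule that)
qed

lemma disjoint_refinement:
  assumes sat: "saturated_ideal J" and I: "countable I" and E: "\<And>i. i \<in> I \<Longrightarrow> E i \<notin> J"
  obtains F where "\<And>i. i \<in> I \<Longrightarrow> F i \<subseteq> E i" "\<And>i. i \<in> I \<Longrightarrow> F i \<notin> J" "disjoint_family_on F I"
proof (cases "I = {}")
  case True
  then show ?thesis
    by (intro that[of "\<lambda>_. {}"]) (auto simp: disjoint_family_on_def)
next
  case False
  then obtain F where F: "\<And>k. F k \<subseteq> E (from_nat_into I k)" "\<And>k. F k \<notin> J" "disjoint_family F"
    using disjoint_refinement_nat[OF sat, of "\<lambda>k. E (from_nat_into I k)"] E from_nat_into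
    by metis
  show ?thesis
  proof
    show "F (to_nat_on I i) \<subseteq> E i" if "i \<in> I" for i
      using F(1)[of "to_nat_on I i"] from_nat_into_to_nat_on[OF I that] by simp
    show "disjoint_family_on (\<lambda>i. F (to_nat_on I i)) I"
      using F(3) to_nat_on_inj[OF I] by (auto simp: disjoint_family_on_def)
  qed (rule F(2))
qed

text \<open>As \<open>V\<close> is closed under unions, removing finitely many members from
  \<open>p\<close> leaves a positive set. These sets decrease along an enumeration of
  \<open>V\<close>, and \<open>c\<close> is a lower bound of them.\<close>

lemma avoid_ideal:
  assumes sat: "saturated_ideal J" and V: "countable V" "V \<noteq> {}"
    and Un: "\<And>v w. v \<in> V \<Longrightarrow> w \<in> V \<Longrightarrow> v \<union> w \<in> V" and p: "\<And>v. v \<in> V \<Longrightarrow> p - v \<notin> J"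
  obtains c where "c \<subseteq> p" "c \<notin> J" "\<And>v. v \<in> V \<Longrightarrow> c \<inter> v \<in> J"
proof -
  have J: "set_ideal J"
    using sat by (simp add: saturated_ideal_def)
  define v where "v = from_nat_into V"
  have v: "range v = V"
    using V by (simp add: v_def range_from_nat_into)
  have mem: "(\<Union>i\<le>n. v i) \<in> V" for n
  proof (induction n)
    case (Suc n)
    have "v (Suc n) \<in> V"
      using v by (metis rangeI)
    moreover have "(\<Union>i\<le>Suc n. v i) = v (Suc n) \<union> (\<Union>i\<le>n. v i)"
      by (simp add: atMost_Suc)
    ultimately show ?case
      using Un Suc by simp
  qed (use v in auto)
  have "decseq (\<lambda>n. p - (\<Union>i\<le>n. v i))"
    unfolding decseq_def by (intro allI impI Diff_mono UN_mono order_refl) simp_all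
  then obtain c where c: "c \<subseteq> p - (\<Union>i\<le>0. v i)" "c \<notin> J" "\<And>n. c - (p - (\<Union>i\<le>n. v i)) \<in> J"
    by (rule saturated_ideal_lower_bound[OF sat]) (use p mem in blast)+
  show thesis
  proof
    fix w assume "w \<in> V"
    then obtain n where "w = v n"
      using v by blast
    then show "c \<inter> w \<in> J"
      by (intro ideal_mono[OF J c(3)[of n]]) auto
  qed (use c(1,2) in auto)
qed

text \<open>Diagonal construction: \<open>u n\<close> is put into \<open>b\<close> after losing
  \<open>v 0\<close> to \<open>v n\<close>. Then \<open>u n - b\<close> is covered by finitely many
  sets \<open>u n \<inter> v j\<close>, and \<open>b\<close> meets \<open>v n\<close> only inside
  the sets \<open>u i\<close> with \<open>i < n\<close>.\<close>

lemma countable_separation: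
  assumes J: "set_ideal J" and U: "countable U" and V: "countable V"
    and UV: "\<And>u v. u \<in> U \<Longrightarrow> v \<in> V \<Longrightarrow> u \<inter> v \<in> J"
  obtains b where "\<And>u. u \<in> U \<Longrightarrow> u - b \<in> J" "\<And>v. v \<in> V \<Longrightarrow> b \<inter> v \<in> J"
proof -
  \<comment> \<open>The inserted empty set makes the families nonempty, hence enumerable by
    \<open>nat\<close>.\<close>
  obtain u :: "nat \<Rightarrow> _" where u: "range u = insert {} U"
    using uncountable_def[of "insert {} U"] U by auto
  obtain v :: "nat \<Rightarrow> _" where v: "range v = insert {} V"
    using uncountable_def[of "insert {} V"] V by auto
  have uv: "u i \<inter> v j \<in> J" for i j
  proof -
    have "u i \<in> insert {} U" "v j \<in> insert {} V"
      by (simp_all only: u[symmetric] v[symmetric] rangeI)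
    then show ?thesis
      using UV ideal_empty[OF J] by auto
  qed
  define b where "b = (\<Union>n. u n - (\<Union>j\<le>n. v j))"
  show thesis
  proof
    fix w assume "w \<in> U"
    then obtain n where n: "w = u n"
      using u by blast
    have "(\<Union>j\<le>n. u n \<inter> v j) \<in> J"
      by (intro ideal_UN[OF J]) (auto simp: uv)
    then show "w - b \<in> J"
      by (rule ideal_mono[OF J]) (auto simp: b_def n)
  next
    fix w assume "w \<in> V"
    then obtain n where n: "w = v n"
      using v by blast
    have "(\<Union>i<n. u i \<inter> v n) \<in> J"
      by (intro ideal_UN[OF J]) (auto simp: uv)
    moreover have "b \<inter> w \<subseteq> (\<Union>i<n. u i \<inter> v n)"
      proof
      fix x assume "x \<in> b \<inter> w"
      then obtain i where "x \<in> u i" "\<forall>j\<le>i. x \<notin> v j" "x \<in> v n"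
        unfolding b_def n by blast
      then show "x \<in> (\<Union>i<n. u i \<inter> v n)"
        using not_le by blast
    qed
    ultimately show "b \<inter> w \<in> J"
      by (rule ideal_mono[OF J])
  qed
qed

text \<open>\<open>U\<close> and \<open>V\<close> are to lie inside and outside \<open>b\<close>
  modulo the ideal; members of \<open>P\<close> and \<open>Q\<close> are to meet \<open>b\<close>
  and its complement in positive sets. Each \<open>p\<close> has a positive part almost disjoint
  from all of \<open>V\<close>, each \<open>q\<close> one almost disjoint from all of
  \<open>U\<close>. Once shrunk to be disjoint, these parts join the two sides of a countable
  separation.\<close>

lemma realize_type:
  assumes sat: "saturated_ideal K"
    and cnt: "countable U" "countable V" "countable P" "countable Q"
    and ne: "U \<noteq> {}" "V \<noteq> {}"
    and U_Un: "\<And>u u'. u \<in> U \<Longrightarrow> u' \<in> U \<Longrightarrow> u \<union> u' \<in> U"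
    and V_Un: "\<And>v v'. v \<in> V \<Longrightarrow> v' \<in> V \<Longrightarrow> v \<union> v' \<in> V"
    and UV: "\<And>u v. u \<in> U \<Longrightarrow> v \<in> V \<Longrightarrow> u \<inter> v \<in> K"
    and PV: "\<And>p v. p \<in> P \<Longrightarrow> v \<in> V \<Longrightarrow> p - v \<notin> K"
    and QU: "\<And>q u. q \<in> Q \<Longrightarrow> u \<in> U \<Longrightarrow> q - u \<notin> K"
  obtains b where "\<And>u. u \<in> U \<Longrightarrow> u - b \<in> K" "\<And>v. v \<in> V \<Longrightarrow> v \<inter> b \<in> K"
    "\<And>p. p \<in> P \<Longrightarrow> p \<inter> b \<notin> K" "\<And>q. q \<in> Q \<Longrightarrow> q - b \<notin> K"
proof -
  have K: "set_ideal K"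
    using sat by (simp add: saturated_ideal_def)
  have "\<exists>c. c \<subseteq> p \<and> c \<notin> K \<and> (\<forall>v\<in>V. c \<inter> v \<in> K)" if "p \<in> P" for p
    by (rule avoid_ideal[OF sat cnt(2) ne(2) V_Un PV[OF that]]) blast+
  then obtain c where c: "\<And>p. p \<in> P \<Longrightarrow> c p \<subseteq> p" "\<And>p. p \<in> P \<Longrightarrow> c p \<notin> K"
    "\<And>p v. p \<in> P \<Longrightarrow> v \<in> V \<Longrightarrow> c p \<inter> v \<in> K"
    by metis
  have "\<exists>d. d \<subseteq> q \<and> d \<notin> K \<and> (\<forall>u\<in>U. d \<inter> u \<in> K)" if "q \<in> Q" for q
    by (rule avoid_ideal[OF sat cnt(1) ne(1) U_Un QU[OF that]]) blast+
  then obtain d where d: "\<And>q. q \<in> Q \<Longrightarrow> d q \<subseteq> q" "\<And>q. q \<in> Q \<Longrightarrow> d q \<notin> K"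
    "\<And>q u. q \<in> Q \<Longrightarrow> u \<in> U \<Longrightarrow> d q \<inter> u \<in> K"
    by metis
  \<comment> \<open>Both kinds of demands are refined together, so that pieces for \<open>P\<close>
    also become disjoint from pieces for \<open>Q\<close>.\<close>
  define E where "E = case_sum c d"
  have E: "E i \<notin> K" if "i \<in> P <+> Q" for i
    using that c(2) d(2) by (auto simp: E_def)
  obtain F where F: "\<And>i. i \<in> P <+> Q \<Longrightarrow> F i \<subseteq> E i" "\<And>i. i \<in> P <+> Q \<Longrightarrow> F i \<notin> K"
    "disjoint_family_on F (P <+> Q)"
    by (rule disjoint_refinement[OF sat countable_Plus[OF cnt(3,4)]]) (erule E, rule that)
  have FP: "F (Inl p) \<subseteq> c p" "F (Inl p) \<notin> K" if "p \<in> P" for p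
    using F(1,2)[of "Inl p"] that by (auto simp: E_def)
  have FQ: "F (Inr q) \<subseteq> d q" "F (Inr q) \<notin> K" if "q \<in> Q" for q
    using F(1,2)[of "Inr q"] that by (auto simp: E_def)
  have PQ: "F (Inl p) \<inter> F (Inr q) = {}" if "p \<in> P" "q \<in> Q" for p q
    using F(3) that by (auto simp: disjoint_family_on_def)
  have "\<exists>b. (\<forall>u \<in> U \<union> (\<lambda>p. F (Inl p)) ` P. u - b \<in> K) \<and> (\<forall>v \<in> V \<union> (\<lambda>q. F (Inr q)) ` Q. b \<inter> v \<in> K)"
  proof (rule countable_separation[OF K])
    show "countable (U \<union> (\<lambda>p. F (Inl p)) ` P)" "countable (V \<union> (\<lambda>q. F (Inr q)) ` Q)"
      using cnt by auto
    fix u v assume "u \<in> U \<union> (\<lambda>p. F (Inl p)) ` P" "v \<in> V \<union> (\<lambda>q. F (Inr q)) ` Q"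
    then consider "u \<in> U" "v \<in> V" | q where "u \<in> U" "q \<in> Q" "v = F (Inr q)"
      | p where "p \<in> P" "u = F (Inl p)" "v \<in> V"
      | p q where "p \<in> P" "u = F (Inl p)" "q \<in> Q" "v = F (Inr q)"
      by blast
    then show "u \<inter> v \<in> K"
    proof cases
      case 1
      then show ?thesis by (rule UV)
    next
      case 2
      then show ?thesis
        using FQ(1)[of q] by (intro ideal_mono[OF K d(3)[of q u]]) auto
    next
      case 3
      then show ?thesis
        using FP(1)[of p] by (intro ideal_mono[OF K c(3)[of p v]]) auto
    next
      case 4
      then show ?thesis
        by (simp add: PQ ideal_empty[OF K])
    qed
  qed blast
  then obtain b where b: "\<forall>u \<in> U \<union> (\<lambda>p. F (Inl p)) ` P. u - b \<in> K"
    "\<forall>v \<in> V \<union> (\<lambda>q. F (Inr q)) ` Q. b \<inter> v \<in> K"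
    by blast
  then have b: "\<And>u. u \<in> U \<Longrightarrow> u - b \<in> K" "\<And>p. p \<in> P \<Longrightarrow> F (Inl p) - b \<in> K"
    "\<And>v. v \<in> V \<Longrightarrow> b \<inter> v \<in> K" "\<And>q. q \<in> Q \<Longrightarrow> b \<inter> F (Inr q) \<in> K"
    by simp_all
  show thesis
  proof
    show "v \<inter> b \<in> K" if "v \<in> V" for v
      using b(3)[OF that] by (simp add: Int_commute)
    fix p assume p: "p \<in> P"
    show "p \<inter> b \<notin> K"
    proof
      assume "p \<inter> b \<in> K"
      from ideal_Un[OF K this b(2)[OF p]] have "F (Inl p) \<in> K"
        by (rule ideal_mono[OF K]) (use FP(1)[OF p] c(1)[OF p] in auto)
      with FP(2)[OF p] show False by contradiction
    qed
  next
    fix q assume q: "q \<in> Q"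
    show "q - b \<notin> K"
    proof
      assume "q - b \<in> K"
      from ideal_Un[OF K this b(4)[OF q]] have "F (Inr q) \<in> K"
        by (rule ideal_mono[OF K]) (use FQ(1)[OF q] d(1)[OF q] in auto)
      with FQ(2)[OF q] show False by contradiction
    qed
  qed (rule b(1))
qed

section \<open>Extending a countable partial isomorphism by one set\<close>

text \<open>The partner \<open>B\<close> of \<open>A\<close> has to stand in the same relation to
  the images as \<open>A\<close> does to the originals, which is a countable type over
  \<open>K\<close>. The correspondence then extends to the algebra generated by
  \<open>A\<close>.\<close>

lemma bool_corr_extend_Domain:
  fixes J :: "'a set set" and K :: "'b set set"
  assumes J: "set_ideal J" and sat: "saturated_ideal K"
    and R: "bool_corr J K R" and cnt: "countable R"
  obtains R' where "R \<subseteq> R'" "bool_corr J K R'" "countable R'" "A \<in> Domain R'"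
proof -
  have K: "set_ideal K"
    using sat by (simp add: saturated_ideal_def)
  \<comment> \<open>The type of \<open>A\<close>, moved to the other side: the images of sets almost
    contained in \<open>A\<close>, almost disjoint from \<open>A\<close>, positive inside
    \<open>A\<close> and positive outside \<open>A\<close>.\<close>
  define U where "U = {X'. \<exists>X. (X, X') \<in> R \<and> X - A \<in> J}"
  define V where "V = {X'. \<exists>X. (X, X') \<in> R \<and> X \<inter> A \<in> J}"
  define P where "P = {X'. \<exists>X. (X, X') \<in> R \<and> X \<inter> A \<notin> J}"
  define Q where "Q = {X'. \<exists>X. (X, X') \<in> R \<and> X - A \<notin> J}"
  have "countable (snd ` R)"
    using cnt by simp
  moreover have "U \<subseteq> snd ` R" "V \<subseteq> snd ` R" "P \<subseteq> snd ` R" "Q \<subseteq> snd ` R"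
    by (force simp: U_def V_def P_def Q_def)+
  ultimately have cnts: "countable U" "countable V" "countable P" "countable Q"
    by (meson countable_subset)+
  have emp: "({}, {}) \<in> R"
    using bool_corr_Compl[OF R bool_corr_UNIV[OF R]] by simp
  have ne: "{} \<in> U" "{} \<in> V"
    using emp ideal_empty[OF J] by (auto simp: U_def V_def)
  obtain B where B: "\<And>u. u \<in> U \<Longrightarrow> u - B \<in> K" "\<And>v. v \<in> V \<Longrightarrow> v \<inter> B \<in> K"
    "\<And>p. p \<in> P \<Longrightarrow> p \<inter> B \<notin> K" "\<And>q. q \<in> Q \<Longrightarrow> q - B \<notin> K"
  proof (rule realize_type[OF sat cnts])
    show "u \<union> u' \<in> U" if "u \<in> U" "u' \<in> U" for u u'
    proof -
      obtain X X' where "(X, u) \<in> R" "X - A \<in> J" "(X', u') \<in> R" "X' - A \<in> J"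
        using \<open>u \<in> U\<close> \<open>u' \<in> U\<close> by (auto simp: U_def)
      then show ?thesis
        unfolding U_def using bool_corr_Un[OF R] ideal_Un[OF J]
        by (intro CollectI exI[of _ "X \<union> X'"]) (simp add: Un_Diff)
    qed
    show "u \<union> u' \<in> V" if "u \<in> V" "u' \<in> V" for u u'
    proof -
      obtain X X' where "(X, u) \<in> R" "X \<inter> A \<in> J" "(X', u') \<in> R" "X' \<inter> A \<in> J"
        using \<open>u \<in> V\<close> \<open>u' \<in> V\<close> by (auto simp: V_def)
      then show ?thesis
        unfolding V_def using bool_corr_Un[OF R] ideal_Un[OF J]
        by (intro CollectI exI[of _ "X \<union> X'"]) (simp add: Int_Un_distrib2)
    qed
    show "u \<inter> v \<in> K" if *: "u \<in> U" "v \<in> V" for u v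
    proof -
      obtain X Y where XY: "(X, u) \<in> R" "X - A \<in> J" "(Y, v) \<in> R" "Y \<inter> A \<in> J"
        using * unfolding U_def V_def by blast
      from ideal_Un[OF J XY(2,4)] have "X \<inter> Y \<in> J"
        by (rule ideal_mono[OF J]) auto
      then show ?thesis
        using bool_corr_ideal[OF R bool_corr_Int[OF R XY(1,3)]] by simp
    qed
    show "p - v \<notin> K" if *: "p \<in> P" "v \<in> V" for p v
    proof -
      obtain X Y where XY: "(X, p) \<in> R" "X \<inter> A \<notin> J" "(Y, v) \<in> R" "Y \<inter> A \<in> J"
        using * unfolding P_def V_def by blast
      have "X - Y \<notin> J"
      proof
        assume "X - Y \<in> J"
        from ideal_Un[OF J this XY(4)] have "X \<inter> A \<in> J"
          by (rule ideal_mono[OF J]) auto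
        with XY show False by blast
      qed
      then show ?thesis
        using bool_corr_ideal[OF R bool_corr_Diff[OF R XY(1,3)]] by simp
    qed
    show "q - u \<notin> K" if *: "q \<in> Q" "u \<in> U" for q u
    proof -
      obtain X Y where XY: "(X, q) \<in> R" "X - A \<notin> J" "(Y, u) \<in> R" "Y - A \<in> J"
        using * unfolding Q_def U_def by blast
      have "X - Y \<notin> J"
      proof
        assume "X - Y \<in> J"
        from ideal_Un[OF J this XY(4)] have "X - A \<in> J"
          by (rule ideal_mono[OF J]) auto
        with XY show False by blast
      qed
      then show ?thesis
        using bool_corr_ideal[OF R bool_corr_Diff[OF R XY(1,3)]] by simp
    qed
  qed ((use ne in blast)[1], (use ne in blast)[1], rule that)
  \<comment> \<open>\<open>V\<close> and \<open>P\<close> are complementary demands, and so are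
    \<open>U\<close> and \<open>Q\<close>; together they turn the implications for \<open>B\<close>
    into equivalences.\<close>
  have in_iff: "X \<inter> A \<in> J \<longleftrightarrow> X' \<inter> B \<in> K" if "(X, X') \<in> R" for X X'
    using B(2,3)[of X'] that by (auto simp: V_def P_def)
  have diff_iff: "X - A \<in> J \<longleftrightarrow> X' - B \<in> K" if "(X, X') \<in> R" for X X'
    using B(1,4)[of X'] that by (auto simp: U_def Q_def)
  \<comment> \<open>Normal form of the elements of the algebra generated by \<open>A\<close> over
    the old domain: one old set inside \<open>A\<close>, another outside. Boolean operations act on
    the two components separately.\<close>
  define g :: "(('a set \<times> 'b set) \<times> ('a set \<times> 'b set)) \<Rightarrow> 'a set \<times> 'b set"
    where "g = (\<lambda>((X, X'), (Y, Y')). ((X \<inter> A) \<union> (Y - A), (X' \<inter> B) \<union> (Y' - B)))"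
  have gI: "((X \<inter> A) \<union> (Y - A), (X' \<inter> B) \<union> (Y' - B)) \<in> g ` (R \<times> R)"
    if "(X, X') \<in> R" "(Y, Y') \<in> R" for X X' Y Y'
    using that by (force simp: g_def image_iff)
  have gE: "\<exists>X X' Y Y'. (X, X') \<in> R \<and> (Y, Y') \<in> R \<and> C = (X \<inter> A) \<union> (Y - A) \<and> D = (X' \<inter> B) \<union> (Y' - B)"
    if "(C, D) \<in> g ` (R \<times> R)" for C D
    using that by (auto simp: g_def)
  show thesis
  proof
    show "R \<subseteq> g ` (R \<times> R)"
    proof clarify
      fix X X' assume "(X, X') \<in> R"
      from gI[OF this this] show "(X, X') \<in> g ` (R \<times> R)"
        by (simp add: Int_Diff_Un)
    qed
    show "countable (g ` (R \<times> R))"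
      using cnt by simp
    show "A \<in> Domain (g ` (R \<times> R))"
      using gI[OF bool_corr_UNIV[OF R] emp] by auto
    show "bool_corr J K (g ` (R \<times> R))"
      unfolding bool_corr_def
    proof (intro conjI allI impI)
      show "(UNIV, UNIV) \<in> g ` (R \<times> R)"
        using gI[OF bool_corr_UNIV[OF R] bool_corr_UNIV[OF R]] by (simp add: Un_Diff_Int Un_commute)
    next
      fix C D C' D' assume "(C, D) \<in> g ` (R \<times> R)" "(C', D') \<in> g ` (R \<times> R)"
      then obtain X X' Y Y' Z Z' W W' where
        R4: "(X, X') \<in> R" "(Y, Y') \<in> R" "(Z, Z') \<in> R" "(W, W') \<in> R" and
        eq: "C = (X \<inter> A) \<union> (Y - A)" "D = (X' \<inter> B) \<union> (Y' - B)"
        "C' = (Z \<inter> A) \<union> (W - A)" "D' = (Z' \<inter> B) \<union> (W' - B)"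
        using gE by meson
      have "C \<inter> C' = ((X \<inter> Z) \<inter> A) \<union> ((Y \<inter> W) - A)" "D \<inter> D' = ((X' \<inter> Z') \<inter> B) \<union> ((Y' \<inter> W') - B)"
        unfolding eq by blast+
      then show "(C \<inter> C', D \<inter> D') \<in> g ` (R \<times> R)"
        using gI[OF bool_corr_Int[OF R R4(1,3)] bool_corr_Int[OF R R4(2,4)]] by simp
    next
      fix C D assume "(C, D) \<in> g ` (R \<times> R)"
      then obtain X X' Y Y' where R2: "(X, X') \<in> R" "(Y, Y') \<in> R" and
        eq: "C = (X \<inter> A) \<union> (Y - A)" "D = (X' \<inter> B) \<union> (Y' - B)"
        using gE by meson
      have "- C = (- X \<inter> A) \<union> (- Y - A)" "- D = (- X' \<inter> B) \<union> (- Y' - B)"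
        unfolding eq by blast+
      then show "(- C, - D) \<in> g ` (R \<times> R)"
        using gI[OF bool_corr_Compl[OF R R2(1)] bool_corr_Compl[OF R R2(2)]] by simp
      have "C \<in> J \<longleftrightarrow> X \<inter> A \<in> J \<and> Y - A \<in> J"
        unfolding eq by (rule ideal_Un_iff[OF J])
      also have "\<dots> \<longleftrightarrow> X' \<inter> B \<in> K \<and> Y' - B \<in> K"
        using in_iff diff_iff R2 by blast
      also have "\<dots> \<longleftrightarrow> D \<in> K"
        unfolding eq by (rule ideal_Un_iff[OF K, symmetric])
      finally show "C \<in> J \<longleftrightarrow> D \<in> K" .
    qed
  qed
qed

lemma countable_converse: "countable R \<Longrightarrow> countable (converse R)"
proof (rule countable_subset)
  show "converse R \<subseteq> prod.swap ` R"
    by (auto simp: pair_in_swap_image)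
qed simp

text \<open>Forth, then back: the range is enlarged by extending the domain of the converse.\<close>

lemma bool_corr_extend:
  assumes J: "saturated_ideal J" and K: "saturated_ideal K"
    and R: "bool_corr J K R" "countable R"
  obtains R' where "R \<subseteq> R'" "bool_corr J K R'" "countable R'" "A \<in> Domain R'" "B \<in> Range R'"
proof -
  have ideals: "set_ideal J" "set_ideal K"
    using J K by (auto simp: saturated_ideal_def)
  obtain S where S: "R \<subseteq> S" "bool_corr J K S" "countable S" "A \<in> Domain S"
    using bool_corr_extend_Domain[OF ideals(1) K R] by metis
  have "countable (S\<inverse>)"
    using S(3) by (rule countable_converse)
  then obtain S' where S': "S\<inverse> \<subseteq> S'" "bool_corr K J S'" "countable S'" "B \<in> Domain S'"
    using bool_corr_extend_Domain[OF ideals(2) J bool_corr_converse[OF S(2)]] by metis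
  show thesis
  proof
    show "R \<subseteq> S'\<inverse>"
      using S(1) S'(1) by auto
    then show "A \<in> Domain (S'\<inverse>)"
      using S(4) S'(1) by auto
    show "B \<in> Range (S'\<inverse>)"
      using S'(4) by simp
    show "bool_corr J K (S'\<inverse>)"
      by (rule bool_corr_converse[OF S'(2)])
    show "countable (S'\<inverse>)"
      using S'(3) by (rule countable_converse)
  qed
qed

section \<open>Transfinite recursion of length omega one\<close>

text \<open>A strict well-order of \<open>W\<close> of type \<open>\<omega>\<^sub>1\<close>:
  uncountable, with countable proper initial segments.\<close>

definition omega1_order :: "'a set \<Rightarrow> 'a rel \<Rightarrow> bool" where
  "omega1_order W r \<longleftrightarrow> r \<subseteq> W \<times> W \<and> wf r \<and> trans r \<and> total_on W r \<and> uncountable W \<and>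
     (\<forall>x. countable {y. (y, x) \<in> r})"

text \<open>Well-order the whole type. If some proper initial segment is uncountable, cut at the
  least point that has such a segment.\<close>

lemma omega1_order_exists:
  assumes "uncountable (UNIV :: 'a set)"
  obtains W :: "'a set" and r where "omega1_order W r"
proof -
  obtain r0 :: "'a rel" where r0: "Well_order r0" "Field r0 = UNIV"
    using well_ordering[where 'a = 'a] by (elim exE conjE)
  define r where "r = r0 - Id"
  have wf: "wf r"
    using r0 by (simp add: r_def well_order_on_def)
  have tr: "trans r"
    using r0 by (auto simp: r_def order_on_defs intro: trans_diff_Id)
  have tot: "total_on A r" for A
    using r0 by (auto simp: r_def order_on_defs total_on_def)
  show thesis
  proof (cases "\<forall>x. countable {y. (y, x) \<in> r}")
    case True
    then have "omega1_order UNIV r"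
      using wf tr tot assms by (simp add: omega1_order_def)
    then show thesis
      by (rule that)
  next
    case False
    then have "{x. uncountable {y. (y, x) \<in> r}} \<noteq> {}"
      by simp
    then obtain x where "x \<in> {x. uncountable {y. (y, x) \<in> r}}"
      and "\<And>z. (z, x) \<in> r \<Longrightarrow> z \<notin> {x. uncountable {y. (y, x) \<in> r}}"
      by (rule wfE_min'[OF wf]) (blast intro: that)
    then have x: "uncountable {y. (y, x) \<in> r}"
      and min: "\<And>z. (z, x) \<in> r \<Longrightarrow> countable {y. (y, z) \<in> r}"
      by simp_all
    define W where "W = {y. (y, x) \<in> r}"
    have "omega1_order W (Restr r W)"
      unfolding omega1_order_def
    proof (intro conjI allI)
      show "wf (Restr r W)"
        by (rule wf_subset[OF wf]) auto
      show "trans (Restr r W)"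
        using tr by (rule trans_Restr)
      show "total_on W (Restr r W)"
        using tot[of W] by (auto simp: total_on_def)
      show "uncountable W"
        using x by (simp add: W_def)
      fix z
      have "countable {y. (y, z) \<in> r}" if "z \<in> W"
        using that min by (simp add: W_def)
      then show "countable {y. (y, z) \<in> Restr r W}"
        by (cases "z \<in> W") (auto elim: countable_subset[rotated])
    qed auto
    then show thesis
      by (rule that)
  qed
qed

section \<open>Back and forth along an order of type \<open>\<omega>\<^sub>1\<close>\<close>

lemma directed_Union_bool_corr:
  assumes ne: "\<R> \<noteq> {}" and corr: "\<And>R. R \<in> \<R> \<Longrightarrow> bool_corr J K R"
    and chain: "\<And>R S. R \<in> \<R> \<Longrightarrow> S \<in> \<R> \<Longrightarrow> R \<subseteq> S \<or> S \<subseteq> R"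
  shows "bool_corr J K (\<Union>\<R>)"
  unfolding bool_corr_def
proof (intro conjI allI impI)
  show "(UNIV, UNIV) \<in> \<Union>\<R>"
    using ne bool_corr_UNIV[OF corr] by blast
next
  fix A B A' B' assume "(A, B) \<in> \<Union>\<R>" "(A', B') \<in> \<Union>\<R>"
  then obtain R S where RS: "R \<in> \<R>" "(A, B) \<in> R" "S \<in> \<R>" "(A', B') \<in> S"
    by blast
  then obtain T where "T \<in> \<R>" "(A, B) \<in> T" "(A', B') \<in> T"
    using chain[OF RS(1,3)] by blast
  then show "(A \<inter> A', B \<inter> B') \<in> \<Union>\<R>"
    using bool_corr_Int[OF corr] by blast
next
  fix A B assume "(A, B) \<in> \<Union>\<R>"
  then obtain R where R: "R \<in> \<R>" "(A, B) \<in> R"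
    by blast
  show "(- A, - B) \<in> \<Union>\<R>"
    using bool_corr_Compl[OF corr[OF R(1)] R(2)] R(1) by blast
  show "A \<in> J \<longleftrightarrow> B \<in> K"
    by (rule bool_corr_ideal[OF corr[OF R(1)] R(2)])
qed

lemma bool_corr_trivial:
  assumes "saturated_ideal J" "saturated_ideal K"
  shows "bool_corr J K {(UNIV, UNIV), ({}, {})}"
  using assms by (auto simp: bool_corr_def saturated_ideal_def ideal_empty)

text \<open>Stage \<open>x\<close> unites the earlier stages, which stays countable because
  \<open>x\<close> has countably many predecessors, and adds \<open>\<phi> x\<close> to the domain
  and \<open>\<psi> x\<close> to the range. As \<open>\<phi>\<close> and \<open>\<psi>\<close>
  enumerate all sets along \<open>W\<close>, the union of all stages is total and onto.\<close>

lemma back_and_forth: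
  fixes J :: "'a set set" and K :: "'b set set"
  assumes J: "saturated_ideal J" and K: "saturated_ideal K"
    and W: "omega1_order (W :: 'c set) r"
    and \<phi>: "\<phi> ` W = (UNIV :: 'a set set)" and \<psi>: "\<psi> ` W = (UNIV :: 'b set set)"
  obtains R where "bool_corr J K R" "Domain R = UNIV" "Range R = UNIV"
proof -
  have wf: "wf r" and tr: "trans r" and tot: "total_on W r" and seg: "countable {y. (y, x) \<in> r}" for x
    using W by (auto simp: omega1_order_def)
  define P where "P = (\<lambda>f x (R :: ('a set \<times> 'b set) set). bool_corr J K R \<and> countable R \<and>
    (\<forall>y. (y, x) \<in> r \<longrightarrow> f y \<subseteq> R) \<and> \<phi> x \<in> Domain R \<and> \<psi> x \<in> Range R)"
  have "\<exists>f. \<forall>x. P f x (f x)"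
  proof (rule dependent_wf_choice[OF wf])
    fix f g :: "'c \<Rightarrow> ('a set \<times> 'b set) set" and x R
    assume "\<And>z. (z, x) \<in> r \<Longrightarrow> f z = g z"
    then show "P f x R = P g x R"
      by (simp add: P_def cong: imp_cong)
  next
    fix x f assume f: "\<And>y. (y, x) \<in> r \<Longrightarrow> P f y (f y)"
    \<comment> \<open>The trivial correspondence keeps the family nonempty when \<open>x\<close> has
      no predecessors. It is contained in every other member, so the family remains a chain.\<close>
    define \<R> where "\<R> = insert {(UNIV, UNIV), ({}, {})} (f ` {y. (y, x) \<in> r})"
    have corr: "bool_corr J K R" if "R \<in> \<R>" for R
      using that f bool_corr_trivial[OF J K] by (auto simp: \<R>_def P_def)
    have "bool_corr J K (\<Union>\<R>)"
    proof (rule directed_Union_bool_corr[OF _ corr])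
      have base: "{(UNIV, UNIV), ({}, {})} \<subseteq> R" if "R \<in> \<R>" for R
        using bool_corr_UNIV[OF corr[OF that]] bool_corr_Compl[OF corr[OF that], of UNIV UNIV] by auto
      have chain: "f y \<subseteq> f z \<or> f z \<subseteq> f y" if "(y, x) \<in> r" "(z, x) \<in> r" for y z
      proof -
        have "y \<in> W" "z \<in> W"
          using W that by (auto simp: omega1_order_def)
        then have "y = z \<or> (y, z) \<in> r \<or> (z, y) \<in> r"
          using tot by (auto simp: total_on_def)
        then show ?thesis
          using f[OF that(1)] f[OF that(2)] by (auto simp: P_def)
      qed
      show "R \<subseteq> S \<or> S \<subseteq> R" if "R \<in> \<R>" "S \<in> \<R>" for R S
      proof -
        have "R = {(UNIV, UNIV), ({}, {})} \<or> S = {(UNIV, UNIV), ({}, {})} \<or>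
            (\<exists>y z. R = f y \<and> S = f z \<and> (y, x) \<in> r \<and> (z, x) \<in> r)"
          using that unfolding \<R>_def by blast
        then show ?thesis
          using base[OF that(1)] base[OF that(2)] chain by metis
      qed
    qed (simp_all add: \<R>_def)
    moreover have "countable (\<Union>\<R>)"
    proof -
      have "countable (f y)" if "(y, x) \<in> r" for y
        using f[OF that] by (simp add: P_def)
      then have "countable (\<Union>y\<in>{y. (y, x) \<in> r}. f y)"
        by (intro countable_UN seg) simp
      then show ?thesis
        by (simp add: \<R>_def)
    qed
    ultimately obtain R where R: "\<Union>\<R> \<subseteq> R" "bool_corr J K R" "countable R" "\<phi> x \<in> Domain R" "\<psi> x \<in> Range R"
      by (rule bool_corr_extend[OF J K])
    then have "P f x R"
      unfolding P_def \<R>_def by auto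
    then show "\<exists>R. P f x R" ..
  qed
  then obtain f where f: "\<And>x. P f x (f x)"
    by blast
  show thesis
  proof
    show "bool_corr J K (\<Union>(f ` W))"
    proof (rule directed_Union_bool_corr)
      have "W \<noteq> {}"
        using \<phi> by auto
      then show "f ` W \<noteq> {}"
        by simp
      show "bool_corr J K R" if "R \<in> f ` W" for R
        using that f by (auto simp: P_def)
      show "R \<subseteq> S \<or> S \<subseteq> R" if "R \<in> f ` W" "S \<in> f ` W" for R S
      proof -
        obtain y z where yz: "R = f y" "S = f z" "y \<in> W" "z \<in> W"
          using \<open>R \<in> f ` W\<close> \<open>S \<in> f ` W\<close> by blast
        then have "y = z \<or> (y, z) \<in> r \<or> (z, y) \<in> r"
          using tot by (auto simp: total_on_def)
        then show ?thesis
          using f[of y] f[of z] yz by (auto simp: P_def)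
      qed
    qed
    show "Domain (\<Union>(f ` W)) = UNIV"
    proof -
      have "A \<in> Domain (\<Union>(f ` W))" for A
      proof -
        have "A \<in> \<phi> ` W"
          by (simp add: \<phi>)
        then obtain x where x: "x \<in> W" "A = \<phi> x"
          by blast
        then have "A \<in> Domain (f x)"
          using f[of x] by (simp add: P_def)
        then show ?thesis
          using x(1) by auto
      qed
      then show ?thesis
        by (simp add: set_eq_iff)
    qed
    show "Range (\<Union>(f ` W)) = UNIV"
    proof -
      have "A \<in> Range (\<Union>(f ` W))" for A
      proof -
        have "A \<in> \<psi> ` W"
          by (simp add: \<psi>)
        then obtain x where x: "x \<in> W" "A = \<psi> x"
          by blast
        then have "A \<in> Range (f x)"
          using f[of x] by (simp add: P_def)
        then show ?thesis
          using x(1) by auto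
      qed
      then show ?thesis
        by (simp add: set_eq_iff)
    qed
  qed
qed

text \<open>By CH an uncountable set of reals ordered in type \<open>\<omega>\<^sub>1\<close> has
  the size of the continuum, so its points can enumerate all subsets of either countably infinite
  type.\<close>

lemma CH_ring_iso:
  fixes J :: "'a set set" and K :: "'b set set"
  assumes CH and J: "saturated_ideal J" and K: "saturated_ideal K"
    and cnt: "countable (UNIV :: 'a set)" "countable (UNIV :: 'b set)"
    and inf: "infinite (UNIV :: 'a set)" "infinite (UNIV :: 'b set)"
  shows "pow_quotient J \<simeq> pow_quotient K"
proof -
  obtain W :: "real set" and r where W: "omega1_order W r"
    using omega1_order_exists[OF uncountable_UNIV_real] by blast
  have "W \<approx> (UNIV :: real set)"
    using W \<open>CH\<close> by (simp add: omega1_order_def CH_def)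
  then have W_nat: "W \<approx> (UNIV :: nat set set)"
    using eqpoll_trans eqpoll_sym nat_sets_eqpoll_reals by blast
  have sets: "(UNIV :: nat set set) \<approx> (UNIV :: 'c set set)" if "countable (UNIV :: 'c set)" "infinite (UNIV :: 'c set)"
  proof -
    have "bij_betw (from_nat_into (UNIV :: 'c set)) UNIV UNIV"
      using that by (rule bij_betw_from_nat_into)
    then show ?thesis
      unfolding eqpoll_def using bij_betw_Pow by fastforce
  qed
  obtain \<phi> :: "real \<Rightarrow> 'a set" where \<phi>: "\<phi> ` W = UNIV"
    using eqpoll_trans[OF W_nat sets[OF cnt(1) inf(1)]] by (auto simp: eqpoll_def bij_betw_def)
  obtain \<psi> :: "real \<Rightarrow> 'b set" where \<psi>: "\<psi> ` W = UNIV"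
    using eqpoll_trans[OF W_nat sets[OF cnt(2) inf(2)]] by (auto simp: eqpoll_def bij_betw_def)
  obtain R where R: "bool_corr J K R" "Domain R = UNIV" "Range R = UNIV"
    by (rule back_and_forth[OF J K W \<phi> \<psi>])
  then show ?thesis
    using J K ring_iso_of_bool_corr by (metis saturated_ideal_def)
qed

section \<open>The two ideals are saturated\<close>

lemma infinite_halves:
  assumes "infinite A"
  obtains B where "B \<subseteq> A" "infinite B" "infinite (A - B)"
proof -
  obtain B C where "B \<subseteq> A" "C \<subseteq> A" "infinite B" "infinite C" "B \<inter> C = {}"
    using assms by (rule infinite_split)
  moreover from this have "C \<subseteq> A - B"
    by blast
  ultimately show thesis
    using that infinite_super by blast
qed

text \<open>The lower bound is a pseudo-intersection: the range of an increasing sequence that picks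
  its \<open>n\<close>-th term from \<open>B n\<close>.\<close>

lemma saturated_Fin: "saturated_ideal Fin"
  unfolding saturated_ideal_def
proof (intro conjI allI impI)
  show "set_ideal Fin"
    by (rule set_ideal_Fin)
  show "UNIV \<notin> Fin"
    by (simp add: Fin_def)
  fix A assume "A \<notin> Fin"
  then have "infinite A"
    by (simp add: Fin_def)
  then obtain B where "B \<subseteq> A" "infinite B" "infinite (A - B)"
    by (rule infinite_halves)
  then show "\<exists>B\<subseteq>A. B \<notin> Fin \<and> A - B \<notin> Fin"
    by (auto simp: Fin_def)
next
  fix B :: "nat \<Rightarrow> nat set" assume B: "decseq B" "\<forall>n. B n \<notin> Fin"
  have "\<exists>c. \<forall>n. c n \<in> B n \<and> c n < c (Suc n)"
  proof (rule dependent_nat_choice)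
    show "\<exists>x. x \<in> B 0"
      using B(2)[rule_format, of 0] unfolding Fin_def by (auto dest: infinite_imp_nonempty)
    show "\<exists>y. y \<in> B (Suc n) \<and> x < y" for x n
      using B(2)[rule_format, of "Suc n"] unfolding Fin_def by (auto simp: infinite_nat_iff_unbounded)
  qed
  then obtain c where c: "\<And>n. c n \<in> B n" "strict_mono c"
    by (auto simp: strict_mono_Suc_iff)
  show "\<exists>C. C \<notin> Fin \<and> (\<forall>n. C - B n \<in> Fin)"
  proof (intro exI conjI allI)
    show "range c \<notin> Fin"
      using c(2) by (simp add: Fin_def range_inj_infinite strict_mono_imp_inj_on)
    fix n
    have "range c - B n \<subseteq> c ` {..<n}"
    proof clarify
      fix m assume "c m \<notin> B n"
      then have "\<not> n \<le> m"
        using c(1)[of m] B(1) by (auto simp: decseq_def)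
      then show "c m \<in> c ` {..<n}"
        by simp
    qed
    then show "range c - B n \<in> Fin"
      by (auto simp: Fin_def elim: finite_subset)
  qed
qed

section \<open>Branches and combs in the binary tree\<close>

abbreviation branch :: "(nat \<Rightarrow> letter) \<Rightarrow> nat \<Rightarrow> word" where
  "branch y n \<equiv> map y [0..<n]"

lemma prefix_branch_iff: "prefix (branch y m) (branch y n) \<longleftrightarrow> m \<le> n"
proof
  assume "m \<le> n"
  then have "branch y m = take m (branch y n)"
    by (simp add: take_map)
  then show "prefix (branch y m) (branch y n)"
    by (simp only: take_is_prefix)
next
  assume "prefix (branch y m) (branch y n)"
  then show "m \<le> n"
    using prefix_length_le by fastforce
qed

lemma prefix_branchD: "prefix w (branch y n) \<Longrightarrow> w = branch y (length w)"
proof -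
  assume "prefix w (branch y n)"
  then obtain v where v: "branch y n = w @ v"
    by (rule prefixE)
  then have "length w \<le> n"
    by (metis length_append length_map length_upt le_add1 minus_nat.diff_0)
  moreover have "w = take (length w) (branch y n)"
    by (simp only: v) simp
  ultimately show "w = branch y (length w)"
    by (simp add: take_map)
qed

text \<open>A form of Koenig's lemma. In its uses \<open>Q s\<close> says that what lies above
  \<open>s\<close> is still large, and largeness passes to one of the two successors.\<close>

lemma branch_in_tree:
  assumes "Q []" and step: "\<And>s. Q s \<Longrightarrow> Q (s @ [Left]) \<or> Q (s @ [Right])"
  obtains y where "\<And>n. Q (branch y n)"
proof -
  have "\<exists>s. \<forall>n. (Q (s n) \<and> length (s n) = n) \<and> (\<exists>a. s (Suc n) = s n @ [a])"
  proof (rule dependent_nat_choice)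
    show "\<exists>s. Q s \<and> length s = 0"
      using assms(1) by auto
    show "\<exists>t. (Q t \<and> length t = Suc n) \<and> (\<exists>a. t = s @ [a])" if "Q s \<and> length s = n" for s n
      using step[of s] that by (metis length_append_singleton)
  qed
  then obtain s where Q: "\<And>n. Q (s n) \<and> length (s n) = n" and step: "\<And>n. \<exists>a. s (Suc n) = s n @ [a]"
    by blast
  have s: "Q (s n)" "s 0 = []" for n
    using Q[of n] Q[of 0] by simp_all
  then obtain y where y: "\<And>n. s (Suc n) = s n @ [y n]"
    using step by metis
  have "s n = branch y n" for n
    by (induction n) (simp_all add: s(2) y)
  with s(1) show thesis
    by (intro that[of y]) simp
qed

text \<open>Words leaving the branch \<open>y\<close> at larger and larger heights are pairwise incomparable.\<close>

lemma comb_antichain: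
  fixes B :: "nat \<Rightarrow> word set"
  assumes "\<And>n m::nat. \<exists>a\<in>B n. prefix (branch y m) a \<and> a \<notin> range (branch y)"
  obtains a where "\<And>n. a n \<in> B n" "inj a" "antichain (range a)"
proof -
  \<comment> \<open>Each word follows \<open>y\<close> past the whole length of its predecessor; the
    \<open>Suc\<close> makes the lengths strictly increase, which gives injectivity.\<close>
  have "\<exists>a. \<forall>n. (a n \<in> B n \<and> a n \<notin> range (branch y)) \<and> prefix (branch y (Suc (length (a n)))) (a (Suc n))"
    by (rule dependent_nat_choice) (use assms in blast)+
  then obtain a where a: "\<And>n. a n \<in> B n" "\<And>n. a n \<notin> range (branch y)"
    "\<And>n. prefix (branch y (Suc (length (a n)))) (a (Suc n))"
    by blast
  have len: "length (a n) < length (a (Suc n))" for n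
    using prefix_length_le[OF a(3)[of n]] by simp
  then have mono: "strict_mono (\<lambda>n. length (a n))"
    by (simp add: strict_mono_Suc_iff)
  have par: "a i \<parallel> a j" if "i < j" for i j
  proof -
    obtain k where k: "j = Suc k" "i \<le> k"
      using \<open>i < j\<close> by (cases j) (auto simp: less_Suc_eq_le)
    have "Suc (length (a i)) \<le> Suc (length (a k))"
      using monoD[OF strict_mono_mono[OF mono] k(2)] by simp
    then have pre: "prefix (branch y (Suc (length (a i)))) (a j)"
      using a(3)[of k] k(1) prefix_branch_iff prefix_order.trans by blast
    show ?thesis
    proof
      show "\<not> prefix (a j) (a i)"
        using prefix_length_le[OF pre] by (auto dest: prefix_length_le)
      show "\<not> prefix (a i) (a j)"
      proof
        assume "prefix (a i) (a j)"
        then have "prefix (a i) (branch y (Suc (length (a i))))"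
          using pre by (rule prefix_length_prefix) simp
        then show False
          using prefix_branchD a(2) by blast
      qed
    qed
  qed
  show thesis
  proof
    show "inj a"
      using injD[OF strict_mono_imp_inj_on[OF mono]] by (intro injI) simp
    show "antichain (range a)"
      unfolding antichain_def pairwise_def
      using par by (metis imageE linorder_neqE_nat parallel_commute)
  qed (rule a(1))
qed

lemma antichain_subset: "antichain A \<Longrightarrow> B \<subseteq> A \<Longrightarrow> antichain B"
  unfolding antichain_def by (rule pairwise_subset)

lemma antichain_ideal_iff_finite: "antichain A \<Longrightarrow> A \<in> antichain_ideal \<longleftrightarrow> finite A"
  unfolding antichain_ideal_def using antichain_subset finite_subset by blast

lemma chain_in_antichain_ideal:
  assumes "\<And>v w. v \<in> A \<Longrightarrow> w \<in> A \<Longrightarrow> prefix v w \<or> prefix w v"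
  shows "A \<in> antichain_ideal"
proof -
  have "finite C" if C: "C \<subseteq> A" "antichain C" for C
  proof (cases "C = {}")
    case False
    then obtain c where "c \<in> C"
      by blast
    then have "C \<subseteq> {c}"
      using C assms unfolding antichain_def pairwise_def parallel_def by blast
    then show ?thesis
      using finite_subset by blast
  qed simp
  then show ?thesis
    unfolding antichain_ideal_def by blast
qed

lemma range_branch_in_antichain_ideal: "range (branch y) \<in> antichain_ideal"
  by (rule chain_in_antichain_ideal) (auto simp: prefix_branch_iff)

text \<open>For lower bounds, follow a branch above whose nodes every \<open>B n\<close> stays
  positive. The branch itself is a chain, hence in the ideal, so each \<open>B n\<close> has words
  off the branch extending any given node of it. One word from each \<open>B n\<close> gives a comb,
  an infinite antichain almost contained in every \<open>B n\<close>. On antichains the ideal is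
  that of finite sets, so splitting reduces to halving an infinite set.\<close>

lemma saturated_antichain_ideal: "saturated_ideal antichain_ideal"
proof -
  note I = set_ideal_antichain_ideal
  have lower: "\<exists>C. C \<notin> antichain_ideal \<and> (\<forall>n. C - B n \<in> antichain_ideal)"
    if dec: "decseq B" and B: "\<And>n::nat. B n \<notin> antichain_ideal" for B
  proof -
    define Q where "Q s \<longleftrightarrow> (\<forall>n. {w \<in> B n. prefix s w} \<notin> antichain_ideal)" for s
    obtain y where y: "\<And>m. Q (branch y m)"
    proof (rule branch_in_tree[of Q])
      show "Q []"
        using B by (simp add: Q_def)
      fix s assume s: "Q s"
      show "Q (s @ [Left]) \<or> Q (s @ [Right])"
      proof (rule ccontr)
        assume "\<not> (Q (s @ [Left]) \<or> Q (s @ [Right]))"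
        then obtain i j where ij: "{w \<in> B i. prefix (s @ [Left]) w} \<in> antichain_ideal"
          "{w \<in> B j. prefix (s @ [Right]) w} \<in> antichain_ideal"
          by (auto simp: Q_def)
        have "{s} \<in> antichain_ideal"
          by (rule chain_in_antichain_ideal) simp
        note ideal_Un[OF I this ideal_Un[OF I ij]]
        \<comment> \<open>Above \<open>s\<close> there are only \<open>s\<close> itself and the two
          subtrees. Since \<open>B\<close> decreases, the larger index serves both of them.\<close>
        moreover have "{w \<in> B (max i j). prefix s w} \<subseteq>
            {s} \<union> ({w \<in> B i. prefix (s @ [Left]) w} \<union> {w \<in> B j. prefix (s @ [Right]) w})"
        proof
          fix w assume "w \<in> {w \<in> B (max i j). prefix s w}"
          then have w: "w \<in> B (max i j)" "prefix s w"
            by simp_all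
          have wij: "w \<in> B i" "w \<in> B j"
            using w(1) decseqD[OF dec, of i "max i j"] decseqD[OF dec, of j "max i j"] by auto
          obtain v where v: "w = s @ v"
            using w(2) by (rule prefixE)
          show "w \<in> {s} \<union> ({w \<in> B i. prefix (s @ [Left]) w} \<union> {w \<in> B j. prefix (s @ [Right]) w})"
          proof (cases v)
            case (Cons a u)
            then show ?thesis
              using wij v by (cases a) auto
          qed (simp add: v)
        qed
        ultimately have "{w \<in> B (max i j). prefix s w} \<in> antichain_ideal"
          by (rule ideal_mono[OF I])
        with s show False
          by (simp add: Q_def)
      qed
    qed blast
    have comb: "\<exists>a\<in>B n. prefix (branch y m) a \<and> a \<notin> range (branch y)" for n m
    proof (rule ccontr)
      assume "\<not> ?thesis"
      then have "{w \<in> B n. prefix (branch y m) w} \<subseteq> range (branch y)"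
        by blast
      then have "{w \<in> B n. prefix (branch y m) w} \<in> antichain_ideal"
        by (rule ideal_mono[OF I range_branch_in_antichain_ideal])
      then show False
        using y by (simp add: Q_def)
    qed
    obtain a where a: "\<And>n. a n \<in> B n" "inj a" "antichain (range a)"
      using comb_antichain[of B y, OF comb] by blast
    show ?thesis
    proof (intro exI conjI allI)
      show "range a \<notin> antichain_ideal"
        using a by (simp add: antichain_ideal_iff_finite range_inj_infinite)
      fix n
      have "range a - B n \<subseteq> a ` {..<n}"
      proof clarify
        fix m assume "a m \<notin> B n"
        then have "\<not> n \<le> m"
          using a(1)[of m] dec by (auto simp: decseq_def)
        then show "a m \<in> a ` {..<n}"
          by simp
      qed
      then have "finite (range a - B n)"
        by (rule finite_subset) simp
      moreover have "antichain (range a - B n)"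
        using a(3) by (rule antichain_subset) blast
      ultimately show "range a - B n \<in> antichain_ideal"
        by (simp add: antichain_ideal_iff_finite)
    qed
  qed
  have split: "\<exists>B\<subseteq>A. B \<notin> antichain_ideal \<and> A - B \<notin> antichain_ideal" if A: "A \<notin> antichain_ideal" for A
  proof -
    obtain C where C: "C \<subseteq> A" "infinite C" "antichain C"
      using A unfolding antichain_ideal_def by blast
    obtain D where D: "D \<subseteq> C" "infinite D" "infinite (C - D)"
      using C(2) by (rule infinite_halves)
    have "D \<notin> antichain_ideal" "C - D \<notin> antichain_ideal"
      using D antichain_subset[OF C(3)] by (auto simp: antichain_ideal_iff_finite)
    moreover have "C - D \<subseteq> A - D" "D \<subseteq> A"
      using C(1) D(1) by blast+
    ultimately show ?thesis
      using ideal_mono[OF I] by blast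
  qed
  \<comment> \<open>The whole tree is positive: words leave the all-\<open>Left\<close> branch at
    every height.\<close>
  have "\<exists>a\<in>UNIV. prefix (branch (\<lambda>_. Left) m) a \<and> a \<notin> range (branch (\<lambda>_. Left))" for m
  proof (intro bexI conjI)
    show "prefix (branch (\<lambda>_. Left) m) (branch (\<lambda>_. Left) m @ [Right])"
      by simp
    show "branch (\<lambda>_. Left) m @ [Right] \<notin> range (branch (\<lambda>_. Left))"
      by (auto dest!: arg_cong[of _ _ set])
  qed simp
  then obtain a :: "nat \<Rightarrow> word" where a: "inj a" "antichain (range a)"
    by (rule comb_antichain[of "\<lambda>_. UNIV"]) blast
  then have "range a \<notin> antichain_ideal"
    by (simp add: antichain_ideal_iff_finite range_inj_infinite)
  then have "UNIV \<notin> antichain_ideal"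
    using ideal_mono[OF I] by blast
  with I split lower show ?thesis
    by (simp add: saturated_ideal_def)
qed

section \<open>A bounding principle from OCA\<close>

text \<open>The digit \<open>2\<close> never occurs in these ternary expansions, so close codes have a long common part.\<close>

definition ternary :: "nat set \<Rightarrow> real" where
  "ternary A = (\<Sum>n. if n \<in> A then (1/3) ^ n else 0)"

text \<open>The first difference contributes \<open>(1/3) ^ m\<close>; all later digits together can
  cancel at most half of it, by the geometric series.\<close>

lemma ternary_gap_aux:
  assumes m: "m \<in> A" "m \<notin> B" and agree: "\<And>k. k < m \<Longrightarrow> k \<in> A \<longleftrightarrow> k \<in> B"
  shows "(1/3) ^ m / 2 \<le> ternary A - ternary B"
proof -
  define a where "a A = (\<lambda>n. if n \<in> A then (1/3 :: real) ^ n else 0)" for A :: "nat set"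
  have geo: "summable (\<lambda>n. (1/3 :: real) ^ n)"
    by (rule summable_geometric) simp
  have summ: "summable (a C)" for C
    by (rule summable_comparison_test'[OF geo, of 0]) (simp add: a_def)
  define d where "d = (\<lambda>n. a A n - a B n)"
  have "ternary A - ternary B = suminf d"
    using suminf_diff[OF summ summ, of A B] by (simp add: ternary_def a_def d_def)
  also have "\<dots> = (\<Sum>n. d (n + Suc m)) + sum d {..<Suc m}"
    unfolding d_def by (intro suminf_split_initial_segment summable_diff summ)
  also have "sum d {..<Suc m} = (1/3) ^ m"
    using m agree by (simp add: d_def a_def)
  finally have eq: "ternary A - ternary B = (\<Sum>n. d (n + Suc m)) + (1/3) ^ m" .
  have tail: "(\<lambda>n. - ((1/3) ^ (n + Suc m)) :: real) sums (- ((1/3) ^ m / 2))"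
  proof -
    have "(\<lambda>n. - ((1/3) ^ Suc m) * (1/3) ^ n :: real) sums (- ((1/3) ^ Suc m) * (1 / (1 - 1/3)))"
      by (intro sums_mult geometric_sums) simp
    then show ?thesis
      by (simp add: power_add field_simps)
  qed
  have "- ((1/3) ^ m / 2) \<le> (\<Sum>n. d (n + Suc m))"
  proof (rule sums_le[OF _ tail])
    show "- ((1/3) ^ (n + Suc m)) \<le> d (n + Suc m)" for n
      by (simp add: d_def a_def)
    have "summable d"
      unfolding d_def by (intro summable_diff summ)
    then show "(\<lambda>n. d (n + Suc m)) sums (\<Sum>n. d (n + Suc m))"
      by (rule summable_sums[OF summable_ignore_initial_segment])
  qed
  with eq show ?thesis
    by (simp add: field_simps)
qed

lemma ternary_gap:
  assumes "\<bar>ternary A - ternary B\<bar> < (1/3) ^ n / 2"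
  shows "n \<in> A \<longleftrightarrow> n \<in> B"
proof (rule ccontr)
  assume n: "\<not> (n \<in> A \<longleftrightarrow> n \<in> B)"
  define m where "m = (LEAST m. \<not> (m \<in> A \<longleftrightarrow> m \<in> B))"
  have m: "\<not> (m \<in> A \<longleftrightarrow> m \<in> B)"
    unfolding m_def using n by (rule LeastI)
  have "m \<le> n"
    unfolding m_def using n by (rule Least_le)
  then have pow: "(1/3 :: real) ^ n \<le> (1/3) ^ m"
    by (intro power_decreasing) auto
  have agree: "k \<in> A \<longleftrightarrow> k \<in> B" if "k < m" for k
    using not_less_Least[OF that[unfolded m_def]] by blast
  have "(1/3) ^ m / 2 \<le> \<bar>ternary A - ternary B\<bar>"
  proof (cases "m \<in> A")
    case True
    then have "(1/3) ^ m / 2 \<le> ternary A - ternary B"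
      using m agree by (intro ternary_gap_aux) auto
    then show ?thesis
      by linarith
  next
    case False
    then have "(1/3) ^ m / 2 \<le> ternary B - ternary A"
      using m agree by (intro ternary_gap_aux) auto
    then show ?thesis
      by linarith
  qed
  with pow assms show False
    by linarith
qed

lemma inj_ternary: "inj ternary"
proof (rule injI)
  fix A B assume "ternary A = ternary B"
  then have "n \<in> A \<longleftrightarrow> n \<in> B" for n
    by (intro ternary_gap) simp
  then show "A = B"
    by blast
qed

text \<open>OCA for the coloring of pairs of sets by incomparability, moved to the reals by
  \<open>ternary\<close>. The coloring is open because incomparability is witnessed by two
  numbers.\<close>

lemma OCA_nat_sets:
  fixes X :: "nat set set"
  assumes OCA
  obtains (incomparable) Y where "Y \<subseteq> X" "uncountable Y"
      "\<And>A B. A \<in> Y \<Longrightarrow> B \<in> Y \<Longrightarrow> A \<subseteq> B \<Longrightarrow> A = B"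
    | (chains) H where "X = (\<Union>n::nat. H n)" "\<And>n A B. A \<in> H n \<Longrightarrow> B \<in> H n \<Longrightarrow> A \<subseteq> B \<or> B \<subseteq> A"
proof -
  define X' where "X' = ternary ` X"
  define K0 where "K0 = {{ternary A, ternary B} | A B. A \<in> X \<and> B \<in> X \<and> \<not> A \<subseteq> B \<and> \<not> B \<subseteq> A}"
  have tern_eq: "ternary A = ternary B \<longleftrightarrow> A = B" for A B
    using inj_ternary by (auto dest: injD)
  have K0_iff: "{ternary A, ternary B} \<in> K0 \<longleftrightarrow> A \<in> X \<and> B \<in> X \<and> \<not> A \<subseteq> B \<and> \<not> B \<subseteq> A" for A B
    unfolding K0_def by (auto simp: doubleton_eq_iff tern_eq)
  have K0_nsets: "K0 \<subseteq> nsets X' 2"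
    unfolding K0_def X'_def by (auto simp: tern_eq)
  define S where "S = {(x, y). {x, y} \<in> K0}"
  have S_iff: "(ternary A, ternary B) \<in> S \<longleftrightarrow> A \<in> X \<and> B \<in> X \<and> \<not> A \<subseteq> B \<and> \<not> B \<subseteq> A" for A B
    by (simp add: S_def K0_iff)
  have S_sub: "S \<subseteq> X' \<times> X'"
  proof clarify
    fix x y assume "(x, y) \<in> S"
    then have "{x, y} \<in> nsets X' 2"
      using K0_nsets unfolding S_def by blast
    then show "x \<in> X' \<and> y \<in> X'"
      by simp
  qed
  have "openin (top_of_set (X' \<times> X')) S"
    unfolding openin_euclidean_subtopology_iff
  proof (intro conjI ballI S_sub)
    fix p assume "p \<in> S"
    moreover from this obtain A B where p: "p = (ternary A, ternary B)"
      using S_sub by (auto simp: X'_def)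
    ultimately have AB: "A \<in> X" "B \<in> X" "\<not> A \<subseteq> B" "\<not> B \<subseteq> A"
      by (simp_all add: S_iff)
    then obtain i j where ij: "i \<in> A" "i \<notin> B" "j \<in> B" "j \<notin> A"
      by blast
    \<comment> \<open>Codes closer than this agree on both witnesses \<open>i\<close> and
      \<open>j\<close>.\<close>
    define \<delta> :: real where "\<delta> = min ((1/3) ^ i / 2) ((1/3) ^ j / 2)"
    show "\<exists>\<delta>>0. \<forall>q\<in>X' \<times> X'. dist q p < \<delta> \<longrightarrow> q \<in> S"
    proof (intro exI conjI ballI impI)
      show "\<delta> > 0"
        by (simp add: \<delta>_def)
      fix q assume "q \<in> X' \<times> X'" and dist: "dist q p < \<delta>"
      then obtain A' B' where q: "q = (ternary A', ternary B')" "A' \<in> X" "B' \<in> X"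
        by (auto simp: X'_def)
      have "\<bar>ternary A' - ternary A\<bar> \<le> dist q p" "\<bar>ternary B' - ternary B\<bar> \<le> dist q p"
        using dist_fst_le[of q p] dist_snd_le[of q p] by (simp_all add: p q dist_real_def)
      then have "\<bar>ternary A' - ternary A\<bar> < \<delta>" "\<bar>ternary B' - ternary B\<bar> < \<delta>"
        using dist by linarith+
      then have "i \<in> A' \<longleftrightarrow> i \<in> A" "j \<in> A' \<longleftrightarrow> j \<in> A" "i \<in> B' \<longleftrightarrow> i \<in> B" "j \<in> B' \<longleftrightarrow> j \<in> B"
        by (auto intro!: ternary_gap simp: \<delta>_def)
      with ij q show "q \<in> S"
        by (auto simp: S_iff)
    qed
  qed
  moreover have "nsets X' 2 = K0 \<union> (nsets X' 2 - K0)"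
    using K0_nsets by blast
  ultimately consider Y' where "Y' \<subseteq> X'" "uncountable Y'" "nsets Y' 2 \<subseteq> K0"
    | H :: "nat \<Rightarrow> real set" where "X' = (\<Union>n. H n)" "\<And>n. nsets (H n) 2 \<subseteq> nsets X' 2 - K0"
    using \<open>OCA\<close> unfolding OCA_def S_def by metis
  then show thesis
  proof cases
    case 1
    define Y where "Y = {A \<in> X. ternary A \<in> Y'}"
    have Y': "Y' = ternary ` Y"
      using 1(1) by (auto simp: Y_def X'_def)
    show thesis
    proof (rule incomparable)
      show "Y \<subseteq> X"
        by (auto simp: Y_def)
      show "uncountable Y"
        using 1(2) Y' by auto
      fix A B assume AB: "A \<in> Y" "B \<in> Y" "A \<subseteq> B"
      show "A = B"
      proof (rule ccontr)
        assume "A \<noteq> B"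
        then have "{ternary A, ternary B} \<in> nsets Y' 2"
          using AB by (simp add: tern_eq Y_def)
        then show False
          using 1(3) AB(3) K0_iff by blast
      qed
    qed
  next
    case 2
    show thesis
    proof (rule chains[of "\<lambda>n. {A. ternary A \<in> H n}"])
      show "X = (\<Union>n. {A. ternary A \<in> H n})"
      proof (intro Set.set_eqI iffI)
        fix A assume "A \<in> X"
        then have "ternary A \<in> (\<Union>n. H n)"
          unfolding 2(1)[symmetric] X'_def by (rule imageI)
        then show "A \<in> (\<Union>n. {A. ternary A \<in> H n})"
          by blast
      next
        fix A assume "A \<in> (\<Union>n. {A. ternary A \<in> H n})"
        then have "ternary A \<in> X'"
          unfolding 2(1) by blast
        then show "A \<in> X"
          unfolding X'_def by (auto simp: tern_eq)
      qed
      fix n A B assume "A \<in> {A. ternary A \<in> H n}" "B \<in> {A. ternary A \<in> H n}"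
      then have AB: "ternary A \<in> H n" "ternary B \<in> H n"
        by auto
      then have "ternary A \<in> X'" "ternary B \<in> X'"
        unfolding 2(1) by blast+
      then have X: "A \<in> X" "B \<in> X"
        unfolding X'_def by (auto simp: tern_eq)
      show "A \<subseteq> B \<or> B \<subseteq> A"
      proof (cases "A = B")
        case False
        then have "{ternary A, ternary B} \<in> nsets (H n) 2"
          using AB by (simp add: tern_eq)
        then have "{ternary A, ternary B} \<notin> K0"
          using 2(2) by blast
        then show ?thesis
          using X by (simp add: K0_iff)
      qed simp
    qed
  qed
qed

section \<open>Domination modulo finite\<close>

lemma eventually_dominating:
  fixes g :: "nat \<Rightarrow> nat"
  assumes "countable F"
  obtains h where "mono h" "g \<le> h" "\<And>f. f \<in> F \<Longrightarrow> \<forall>\<^sub>F n in sequentially. f n < h n"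
proof -
  obtain e :: "nat \<Rightarrow> nat \<Rightarrow> nat" where e: "range e = insert g F"
    using uncountable_def[of "insert g F"] assms by auto
  \<comment> \<open>The inner sum diagonalizes over the enumeration, the outer sum makes
    \<open>h\<close> monotone, and \<open>Suc\<close> makes the domination strict.\<close>
  define h where "h n = (\<Sum>i\<le>n. Suc (g i + (\<Sum>j\<le>i. e j i)))" for n
  have le: "Suc (g n + (\<Sum>j\<le>n. e j n)) \<le> h n" for n
    unfolding h_def by (rule member_le_sum) auto
  show thesis
  proof
    show "mono h"
      unfolding h_def by (intro monoI sum_mono2) auto
    show "g \<le> h"
      by (rule le_funI) (use le in \<open>metis Suc_leD add_leD1\<close>)
    fix f assume "f \<in> F"
    then obtain j where j: "f = e j"
      using e by (metis imageE insertI2)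
    have "f n < h n" if "j \<le> n" for n
    proof -
      have "e j n \<le> (\<Sum>j\<le>n. e j n)"
        using that by (intro member_le_sum) auto
      then show ?thesis
        using le[of n] j by simp
    qed
    then show "\<forall>\<^sub>F n in sequentially. f n < h n"
      by (auto simp: eventually_sequentially)
  qed
qed

text \<open>Replaces the given functions by larger monotone ones that increase strictly modulo
  finite along \<open>r\<close>; a bound for these also bounds the given ones. The recursion works
  because every point has countably many predecessors.\<close>

lemma dominating_chain:
  fixes g :: "'a \<Rightarrow> nat \<Rightarrow> nat"
  assumes W: "omega1_order W r"
  obtains h where "\<And>x. mono (h x)" "\<And>x. g x \<le> h x"
    "\<And>x y. (x, y) \<in> r \<Longrightarrow> \<forall>\<^sub>F n in sequentially. h x n < h y n"
proof -
  define P where "P = (\<lambda>f x h. mono h \<and> g x \<le> h \<and> (\<forall>y. (y, x) \<in> r \<longrightarrow> (\<forall>\<^sub>F n in sequentially. f y n < h n)))"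
  have "\<exists>h. \<forall>x. P h x (h x)"
  proof (rule dependent_wf_choice)
    show "wf r"
      using W by (simp add: omega1_order_def)
    fix f f' :: "'a \<Rightarrow> nat \<Rightarrow> nat" and x h
    assume "\<And>z. (z, x) \<in> r \<Longrightarrow> f z = f' z"
    then show "P f x h = P f' x h"
      by (simp add: P_def cong: imp_cong)
  next
    fix x and f :: "'a \<Rightarrow> nat \<Rightarrow> nat"
    have "countable (f ` {y. (y, x) \<in> r})"
      using W by (simp add: omega1_order_def)
    then obtain h where "mono h" "g x \<le> h" "\<And>k. k \<in> f ` {y. (y, x) \<in> r} \<Longrightarrow> \<forall>\<^sub>F n in sequentially. k n < h n"
      by (rule eventually_dominating[where g = "g x"]) (blast intro: that)
    then show "\<exists>h. P f x h"
      by (auto simp: P_def)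
  qed
  then obtain f where f: "\<And>x. P f x (f x)"
    by blast
  show thesis
    by (rule that[of f]) (use f in \<open>simp_all add: P_def\<close>)
qed

section \<open>Thinning out families indexed by \<open>\<omega>\<^sub>1\<close>\<close>

lemma uncountable_pigeonhole:
  assumes "uncountable X" and "countable (f ` X)"
  obtains y where "uncountable {x \<in> X. f x = y}"
proof (rule ccontr)
  assume *: "\<not> thesis"
  have "X = (\<Union>y \<in> f ` X. {x \<in> X. f x = y})"
    by auto
  moreover have "countable (\<Union>y \<in> f ` X. {x \<in> X. f x = y})"
    using * that by (intro countable_UN assms(2)) blast
  ultimately show False
    using assms(1) by simp
qed

lemma infinite_image_pigeonhole:
  assumes "infinite (g ` X)" and "finite (f ` X)"
  obtains y where "infinite (g ` {x \<in> X. f x = y})"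
proof (rule ccontr)
  assume *: "\<not> thesis"
  have "g ` X = (\<Union>y \<in> f ` X. g ` {x \<in> X. f x = y})"
    by auto
  moreover have "finite (\<Union>y \<in> f ` X. g ` {x \<in> X. f x = y})"
    using * that by (intro finite_UN_I assms(2)) blast
  ultimately show False
    using assms(1) by simp
qed

text \<open>By totality, a point that is not above \<open>d\<close> is \<open>d\<close> itself or
  one of its countably many predecessors, so countably many \<open>d\<close> exclude only countably
  many points.\<close>

lemma omega1_order_above:
  assumes W: "omega1_order W r" and Z: "Z \<subseteq> W" "uncountable Z" and D: "countable D" "D \<subseteq> W"
  shows "uncountable {z \<in> Z. \<forall>d\<in>D. (d, z) \<in> r}"
proof
  assume c: "countable {z \<in> Z. \<forall>d\<in>D. (d, z) \<in> r}"
  have "Z \<subseteq> {z \<in> Z. \<forall>d\<in>D. (d, z) \<in> r} \<union> (\<Union>d\<in>D. insert d {y. (y, d) \<in> r})"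
    using W Z(1) D(2) unfolding omega1_order_def total_on_def by blast
  moreover have "countable (\<Union>d\<in>D. insert d {y. (y, d) \<in> r})"
    using W D(1) by (auto simp: omega1_order_def)
  ultimately show False
    using c Z(2) by (meson countable_Un countable_subset)
qed

text \<open>
  Some \<open>\<beta>\<close> in \<open>Z\<close> lies above a countable dense subset \<open>D\<close> of \<open>Z\<close>. For uncountably many \<open>\<gamma>\<close> above \<open>\<beta>\<close>
  the comparison \<open>h \<beta> \<le> h \<gamma>\<close> starts at the same place, and \<open>\<gamma>\<close> can be chosen among them to jump, right
  after an initial segment that it shares with some \<open>\<alpha>\<close> in \<open>D\<close>, above the values of \<open>h \<alpha>\<close> up to the
  place where \<open>h \<alpha> \<le> h \<beta>\<close> starts.
\<close>

lemma comparable_pair: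
  fixes h :: "'a \<Rightarrow> nat \<Rightarrow> nat"
  assumes W: "omega1_order W r" and Z: "Z \<subseteq> W" "uncountable Z"
    and mono: "\<And>x. mono (h x)"
    and chain: "\<And>x y. (x, y) \<in> r \<Longrightarrow> \<forall>\<^sub>F n in sequentially. h x n < h y n"
    and unbdd: "\<And>Y. Y \<subseteq> Z \<Longrightarrow> uncountable Y \<Longrightarrow> \<exists>m. infinite ((\<lambda>x. h x m) ` Y)"
  obtains x y where "x \<in> Z" "y \<in> Z" "x \<noteq> y" "h x \<le> h y"
proof -
  define init where "init x m = map (h x) [0..<m]" for x m
  \<comment> \<open>Initial segments are finite lists of numbers, so \<open>L\<close> is countable;
    one representative for each of them gives the dense set \<open>D\<close>.\<close>
  define L where "L = {(m, init x m) | x m. x \<in> Z}"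
  have "\<forall>p\<in>L. \<exists>x\<in>Z. init x (fst p) = snd p"
    by (auto simp: L_def)
  then obtain w where w: "\<And>p. p \<in> L \<Longrightarrow> w p \<in> Z \<and> init (w p) (fst p) = snd p"
    by metis
  define D where "D = w ` L"
  have D: "countable D" "D \<subseteq> Z"
    using w by (auto simp: D_def)
  have dense: "\<exists>x\<in>D. init x m = init z m" if "z \<in> Z" for z m
  proof -
    have "(m, init z m) \<in> L"
      using that by (auto simp: L_def)
    then show ?thesis
      using w unfolding D_def by fastforce
  qed
  have "{z \<in> Z. \<forall>d\<in>D. (d, z) \<in> r} \<noteq> {}"
    using omega1_order_above[OF W Z D(1)] D(2) Z(1) by (metis countable_empty order_trans)
  then obtain \<beta> where \<beta>: "\<beta> \<in> Z" "\<And>d. d \<in> D \<Longrightarrow> (d, \<beta>) \<in> r"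
    by blast
  define Z1 where "Z1 = {z \<in> Z. (\<beta>, z) \<in> r}"
  have Z1: "uncountable Z1"
    using omega1_order_above[OF W Z, of "{\<beta>}"] \<beta>(1) Z(1) by (auto simp: Z1_def)
  have "\<forall>z\<in>Z1. \<exists>n. \<forall>k\<ge>n. h \<beta> k < h z k"
    using chain[of \<beta>] by (auto simp: Z1_def eventually_sequentially)
  then obtain N where N: "\<And>z k. z \<in> Z1 \<Longrightarrow> N z \<le> k \<Longrightarrow> h \<beta> k < h z k"
    by metis
  \<comment> \<open>Fixing the segment of length \<open>N z\<close> along with \<open>N z\<close>
    itself makes all coordinates below \<open>n\<close> constant on \<open>Y\<close>, which will
    force \<open>n \<le> m\<close>.\<close>
  obtain p where p: "uncountable {z \<in> Z1. (N z, init z (N z)) = p}"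
    by (rule uncountable_pigeonhole[OF Z1, of "\<lambda>z. (N z, init z (N z))"]) auto
  define n where "n = fst p"
  define Y where "Y = {z \<in> Z1. (N z, init z (N z)) = p}"
  have Y: "Y \<subseteq> Z" "uncountable Y" "\<And>z. z \<in> Y \<Longrightarrow> z \<in> Z1" "\<And>z. z \<in> Y \<Longrightarrow> N z = n"
    "\<And>z. z \<in> Y \<Longrightarrow> init z n = snd p"
    using p by (auto simp: Y_def Z1_def n_def)
  \<comment> \<open>The first coordinate with infinitely many values on \<open>Y\<close>. Only
    finitely many segments of length \<open>m\<close> occur, so one of them, \<open>s\<close>, still
    allows infinitely many values at \<open>m\<close>.\<close>
  define m where "m = (LEAST m. infinite ((\<lambda>x. h x m) ` Y))"
  have m: "infinite ((\<lambda>x. h x m) ` Y)"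
    unfolding m_def by (rule LeastI_ex) (rule unbdd[OF Y(1,2)])
  have below: "finite ((\<lambda>x. h x k) ` Y)" if "k < m" for k
    using not_less_Least[OF that[unfolded m_def]] by simp
  have "n \<le> m"
  proof (rule ccontr)
    assume "\<not> n \<le> m"
    then have "h z m = snd p ! m" if "z \<in> Y" for z
      using Y(5)[OF that] by (auto simp: init_def dest!: arg_cong[where f="\<lambda>l. l ! m"])
    then have "(\<lambda>x. h x m) ` Y \<subseteq> {snd p ! m}"
      by auto
    with m show False
      using finite_subset by blast
  qed
  have "finite ((\<lambda>x. init x m) ` Y)"
  proof (rule finite_subset)
    have "h x k \<in> (\<Union>k<m. (\<lambda>x. h x k) ` Y)" if "x \<in> Y" "k < m" for x k
      using that by (intro UN_I[of k] image_eqI[of _ _ x]) simp_all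
    then have "set (init x m) \<subseteq> (\<Union>k<m. (\<lambda>x. h x k) ` Y)" if "x \<in> Y" for x
      unfolding init_def set_map set_upt atLeast0LessThan using that by (intro image_subsetI) simp
    moreover have "length (init x m) = m" for x
      by (simp add: init_def)
    ultimately show "(\<lambda>x. init x m) ` Y \<subseteq> {l. set l \<subseteq> (\<Union>k<m. (\<lambda>x. h x k) ` Y) \<and> length l = m}"
      by blast
    show "finite {l. set l \<subseteq> (\<Union>k<m. (\<lambda>x. h x k) ` Y) \<and> length l = m}"
      by (rule finite_lists_length_eq) (use below in auto)
  qed
  then obtain s where s: "infinite ((\<lambda>x. h x m) ` {z \<in> Y. init z m = s})"
    by (rule infinite_image_pigeonhole[OF m])
  then obtain z0 where z0: "z0 \<in> Y" "init z0 m = s"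
    by (metis (mono_tags, lifting) finite.emptyI image_empty mem_Collect_eq subset_empty subsetI)
  obtain \<alpha> where \<alpha>: "\<alpha> \<in> D" "init \<alpha> m = s"
    using dense[of z0 m] z0 Y(1) by auto
  obtain k where k: "\<And>j. k \<le> j \<Longrightarrow> h \<alpha> j < h \<beta> j"
    using chain[OF \<beta>(2)[OF \<alpha>(1)]] by (auto simp: eventually_sequentially)
  obtain v where v: "v \<in> (\<lambda>x. h x m) ` {z \<in> Y. init z m = s}" "h \<alpha> k < v"
    using s by (meson infinite_nat_iff_unbounded)
  then obtain \<gamma> where \<gamma>: "\<gamma> \<in> Y" "init \<gamma> m = s" "h \<alpha> k < h \<gamma> m"
    by auto
  have "h \<alpha> j \<le> h \<gamma> j" for j
  proof -
    \<comment> \<open>Below \<open>m\<close> the segments agree; between \<open>m\<close> and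
      \<open>k\<close> monotonicity preserves the jump of \<open>h \<gamma>\<close>; from
      \<open>k\<close> on the comparison goes through \<open>h \<beta>\<close>.\<close>
    consider "j < m" | "m \<le> j" "j < k" | "m \<le> j" "k \<le> j"
      by linarith
    then show ?thesis
    proof cases
      case 1
      have "init \<alpha> m ! j = init \<gamma> m ! j"
        using \<alpha>(2) \<gamma>(2) by simp
      with 1 show ?thesis
        by (simp add: init_def)
    next
      case 2
      have "h \<alpha> j \<le> h \<alpha> k"
        using 2 mono[of \<alpha>] by (simp add: monoD)
      also have "\<dots> \<le> h \<gamma> m"
        using \<gamma>(3) by simp
      also have "\<dots> \<le> h \<gamma> j"
        using 2 mono[of \<gamma>] by (simp add: monoD)
      finally show ?thesis .
    next
      case 3
      have "h \<alpha> j < h \<beta> j"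
        by (rule k[OF 3(2)])
      also have "\<dots> < h \<gamma> j"
        using N[OF Y(3)[OF \<gamma>(1)]] Y(4)[OF \<gamma>(1)] 3(1) \<open>n \<le> m\<close> by simp
      finally show ?thesis
        by simp
    qed
  qed
  moreover have "\<alpha> \<noteq> \<gamma>"
  proof
    assume "\<alpha> = \<gamma>"
    moreover have "(\<alpha>, \<beta>) \<in> r" "(\<beta>, \<gamma>) \<in> r"
      using \<beta>(2) \<alpha>(1) Y(3)[OF \<gamma>(1)] by (auto simp: Z1_def)
    ultimately show False
      using W by (meson omega1_order_def wf_asym)
  qed
  ultimately show thesis
    using that[of \<alpha> \<gamma>] \<alpha>(1) D(2) \<gamma>(1) Y(1) by (auto simp: le_fun_def)
qed

text \<open>If \<open>Z\<close> were uncountable, each \<open>x\<close> in \<open>Z\<close> would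
  have a successor \<open>s\<close> within \<open>Z\<close>, and \<open>S s\<close> a point outside
  \<open>S x\<close>. That point lies in all later sets, so different \<open>x\<close> receive
  different points of a countable type.\<close>

lemma no_uncountable_strict_chain:
  fixes S :: "'a \<Rightarrow> 'b::countable set"
  assumes W: "omega1_order W r" and Z: "Z \<subseteq> W"
    and strict: "\<And>x y. x \<in> Z \<Longrightarrow> y \<in> Z \<Longrightarrow> (x, y) \<in> r \<Longrightarrow> S x \<subset> S y"
  shows "countable Z"
proof (rule ccontr)
  assume unc: "uncountable Z"
  have wf: "wf r" and tot: "total_on W r"
    using W by (auto simp: omega1_order_def)
  have "\<exists>p. p \<notin> S x \<and> (\<forall>y\<in>Z. (x, y) \<in> r \<longrightarrow> p \<in> S y)" if x: "x \<in> Z" for x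
  proof -
    have "uncountable {z \<in> Z. \<forall>d\<in>{x}. (d, z) \<in> r}"
      by (rule omega1_order_above[OF W Z unc]) (use x Z in auto)
    then have "{z \<in> Z. (x, z) \<in> r} \<noteq> {}"
      by (intro notI) simp
    then obtain s where "s \<in> {z \<in> Z. (x, z) \<in> r}"
      and min: "\<And>y. (y, s) \<in> r \<Longrightarrow> y \<notin> {z \<in> Z. (x, z) \<in> r}"
      by (rule wfE_min'[OF wf]) (blast intro: that)
    then have s: "s \<in> Z" "(x, s) \<in> r"
      by simp_all
    obtain p where p: "p \<in> S s" "p \<notin> S x"
      using strict[OF x s] by blast
    have "p \<in> S y" if y: "y \<in> Z" "(x, y) \<in> r" for y
    proof -
      have "y = s \<or> (s, y) \<in> r"
        using tot min[of y] y s(1) Z by (auto simp: total_on_def)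
      then show ?thesis
        using p(1) strict[OF s(1) y(1)] by blast
    qed
    with p(2) show ?thesis
      by blast
  qed
  then obtain p where p: "\<And>x. x \<in> Z \<Longrightarrow> p x \<notin> S x" "\<And>x y. x \<in> Z \<Longrightarrow> y \<in> Z \<Longrightarrow> (x, y) \<in> r \<Longrightarrow> p x \<in> S y"
    by metis
  have "inj_on p Z"
  proof (rule inj_onI, rule ccontr)
    fix x y assume xy: "x \<in> Z" "y \<in> Z" "p x = p y" "x \<noteq> y"
    then have "(x, y) \<in> r \<or> (y, x) \<in> r"
      using tot Z by (auto simp: total_on_def)
    then show False
      using p xy by metis
  qed
  then have "countable Z"
    by (rule countable_image_inj_on[rotated]) simp
  with unc show False ..
qed

text \<open>In other words, OCA implies that the bounding number exceeds \<open>\<omega>\<^sub>1\<close> (Todorcevic).\<close>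

lemma OCA_bounded:
  fixes g :: "'a \<Rightarrow> nat \<Rightarrow> nat"
  assumes OCA and W: "omega1_order W r"
  obtains (bounded) Y f where "Y \<subseteq> W" "uncountable Y"
    "\<And>x. x \<in> Y \<Longrightarrow> \<forall>\<^sub>F n in sequentially. g x n \<le> f n"
proof (rule ccontr)
  assume neg: "\<not> thesis"
  have no: False if "Y \<subseteq> W" "uncountable Y" "\<And>x. x \<in> Y \<Longrightarrow> \<forall>\<^sub>F n in sequentially. g x n \<le> f n" for Y f
    using neg bounded[OF that] by contradiction
  obtain h where mono: "\<And>x. mono (h x)" and gh: "\<And>x. g x \<le> h x"
    and chain: "\<And>x y. (x, y) \<in> r \<Longrightarrow> \<forall>\<^sub>F n in sequentially. h x n < h y n"
    by (rule dominating_chain[OF W, of g]) (blast intro: that)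
  \<comment> \<open>Otherwise the maxima of the coordinates over \<open>Y\<close> would form a
    function bounding every \<open>g x\<close> with \<open>x \<in> Y\<close>.\<close>
  have unbdd: "\<exists>m. infinite ((\<lambda>x. h x m) ` Y)" if Y: "Y \<subseteq> W" "uncountable Y" for Y
  proof (rule ccontr)
    assume "\<not> ?thesis"
    then have fin: "finite ((\<lambda>x. h x m) ` Y)" for m
      by blast
    show False
    proof (rule no[OF Y])
      fix x assume "x \<in> Y"
      then have "g x m \<le> Max ((\<lambda>x. h x m) ` Y)" for m
        using Max_ge[OF fin, of "h x m" m] gh[of x] by (auto simp: le_fun_def intro: order_trans)
      then show "\<forall>\<^sub>F m in sequentially. g x m \<le> Max ((\<lambda>x. h x m) ` Y)"
        by simp
    qed
  qed
  \<comment> \<open>The region below the graph of \<open>h x\<close>, coded as a set of numbers, so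
    that inclusion becomes the pointwise order.\<close>
  define S where "S x = {prod_encode (i, j) | i j. j < h x i}" for x
  have S_iff: "S x \<subseteq> S y \<longleftrightarrow> h x \<le> h y" for x y
  proof
    assume sub: "S x \<subseteq> S y"
    show "h x \<le> h y"
    proof (rule le_funI, rule ccontr)
      fix i assume "\<not> h x i \<le> h y i"
      then have "prod_encode (i, h y i) \<in> S x"
        by (auto simp: S_def)
      then have "prod_encode (i, h y i) \<in> S y"
        using sub by blast
      then show False
        by (auto simp: S_def)
    qed
  next
    assume "h x \<le> h y"
    then show "S x \<subseteq> S y"
      by (auto simp: S_def le_fun_def intro: less_le_trans)
  qed
  have strict: "\<not> h y \<le> h x" if xy: "(x, y) \<in> r" for x y
  proof
    assume "h y \<le> h x"
    moreover obtain n where "h x n < h y n"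
      using chain[OF xy] by (auto simp: eventually_sequentially)
    ultimately show False
      by (simp add: le_fun_def not_less[symmetric])
  qed
  have tot: "(x, y) \<in> r \<or> (y, x) \<in> r" if "x \<in> W" "y \<in> W" "x \<noteq> y" for x y
    using W that by (auto simp: omega1_order_def total_on_def)
  have inj: "inj_on S W"
    using tot strict S_iff by (intro inj_onI) (metis order_refl)
  from \<open>OCA\<close> show False
  proof (cases rule: OCA_nat_sets[of "S ` W"])
    \<comment> \<open>An uncountable antichain for the pointwise order is excluded by
      \<open>comparable_pair\<close>.\<close>
    case (incomparable \<Y>)
    then obtain Z where Z: "Z \<subseteq> W" "\<Y> = S ` Z"
      by (meson subset_imageE)
    then have unc: "uncountable Z"
      using incomparable(2) by auto
    have unbdd_Z: "\<exists>m. infinite ((\<lambda>x. h x m) ` Y)" if "Y \<subseteq> Z" "uncountable Y" for Y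
      using that Z(1) by (intro unbdd) auto
    obtain x y where xy: "x \<in> Z" "y \<in> Z" "x \<noteq> y" "h x \<le> h y"
      by (rule comparable_pair[OF W Z(1) unc mono chain unbdd_Z])
    then have "S x = S y"
      using incomparable(3)[of "S x" "S y"] Z(2) by (auto simp: S_iff)
    then show False
      using inj xy Z(1) by (auto dest: inj_onD)
  next
    \<comment> \<open>On each \<open>H n\<close> the sets \<open>S x\<close> increase strictly along
      \<open>r\<close>, so countably many such pieces cannot exhaust \<open>W\<close>.\<close>
    case (chains H)
    have "countable {x \<in> W. S x \<in> H n}" for n
    proof (rule no_uncountable_strict_chain[OF W])
      show "S x \<subset> S y" if "x \<in> {x \<in> W. S x \<in> H n}" "y \<in> {x \<in> W. S x \<in> H n}" "(x, y) \<in> r" for x y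
        using chains(2)[of "S x" n "S y"] strict[OF that(3)] that by (auto simp: S_iff less_le_not_le)
    qed auto
    then have "countable (\<Union>n. {x \<in> W. S x \<in> H n})"
      by simp
    moreover have "W \<subseteq> (\<Union>n. {x \<in> W. S x \<in> H n})"
    proof
      fix x assume "x \<in> W"
      moreover from this have "S x \<in> (\<Union>n. H n)"
        unfolding chains(1)[symmetric] by (rule imageI)
      ultimately show "x \<in> (\<Union>n. {x \<in> W. S x \<in> H n})"
        by blast
    qed
    ultimately show False
      using W countable_subset by (auto simp: omega1_order_def)
  qed
qed

section \<open>OCA refutes the isomorphism\<close>

abbreviation comb_tooth :: "nat \<Rightarrow> word" where
  "comb_tooth n \<equiv> replicate n Right @ [Left]"

text \<open>At the position given by the smaller index one tooth has \<open>Left\<close> and the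
  other \<open>Right\<close>; incomparability passes to extensions.\<close>

lemma comb_tooth_parallel:
  assumes "prefix (comb_tooth m) v" "prefix (comb_tooth n) w" "m \<noteq> n"
  shows "v \<parallel> w"
proof -
  have "comb_tooth i \<parallel> comb_tooth j" if "i < j" for i j
  proof -
    have "replicate j Right = replicate i Right @ Right # replicate (j - Suc i) Right"
      using that by (metis Suc_diff_Suc add_diff_inverse_nat less_imp_le_nat not_less replicate_Suc replicate_add)
    then show ?thesis
      by (simp add: parallel_def)
  qed
  then have "comb_tooth m \<parallel> comb_tooth n"
    using assms(3) by (meson linorder_neqE_nat parallel_commute)
  then show ?thesis
    using assms(1,2) by (metis parallel_append prefixE)
qed

text \<open>Infinitely many distinct branches accumulate at some branch \<open>z\<close>. Infinitely
  many pass through each node of \<open>z\<close> and at most one of them is \<open>z\<close>, so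
  words off \<open>z\<close> extend every node of it and contain a comb. Prefixing \<open>u\<close>
  keeps it an antichain.\<close>

lemma infinitely_many_branches:
  assumes T: "infinite T" and y: "inj_on y T"
    and E: "\<And>x k. x \<in> T \<Longrightarrow> u @ branch (y x) k \<in> E"
  shows "E \<notin> antichain_ideal"
proof -
  define Q where "Q s \<longleftrightarrow> infinite {x \<in> T. branch (y x) (length s) = s}" for s
  obtain z where z: "\<And>m. Q (branch z m)"
  proof (rule branch_in_tree[of Q])
    show "Q []"
      using T by (simp add: Q_def)
    fix s assume "Q s"
    moreover have "{x \<in> T. branch (y x) (length s) = s} \<subseteq>
        {x \<in> T. branch (y x) (Suc (length s)) = s @ [Left]} \<union>
        {x \<in> T. branch (y x) (Suc (length s)) = s @ [Right]}"
    proof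
      fix x assume "x \<in> {x \<in> T. branch (y x) (length s) = s}"
      then show "x \<in> {x \<in> T. branch (y x) (Suc (length s)) = s @ [Left]} \<union>
          {x \<in> T. branch (y x) (Suc (length s)) = s @ [Right]}"
        using letter.exhaust[of "y x (length s)"] by force
    qed
    ultimately have "infinite ({x \<in> T. branch (y x) (Suc (length s)) = s @ [Left]} \<union>
        {x \<in> T. branch (y x) (Suc (length s)) = s @ [Right]})"
      unfolding Q_def by (rule infinite_super[rotated])
    then show "Q (s @ [Left]) \<or> Q (s @ [Right])"
      unfolding Q_def finite_Un length_append_singleton by blast
  qed blast
  define B where "B = {branch (y x) k | x k. x \<in> T}"
  have "\<exists>a\<in>B. prefix (branch z m) a \<and> a \<notin> range (branch z)" for m
  proof -
    have inf: "infinite {x \<in> T. branch (y x) m = branch z m}"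
      using z[of m] by (simp add: Q_def)
    have "\<exists>x\<in>T. branch (y x) m = branch z m \<and> y x \<noteq> z"
    proof (rule ccontr)
      assume "\<not> ?thesis"
      then have "y ` {x \<in> T. branch (y x) m = branch z m} \<subseteq> {z}"
        by blast
      then have "finite (y ` {x \<in> T. branch (y x) m = branch z m})"
        by (rule finite_subset) simp
      moreover have "inj_on y {x \<in> T. branch (y x) m = branch z m}"
        using y by (rule inj_on_subset) blast
      ultimately show False
        using inf finite_imageD by blast
    qed
    then obtain x where x: "x \<in> T" "branch (y x) m = branch z m" "y x \<noteq> z"
      by blast
    then obtain i where i: "y x i \<noteq> z i"
      by blast
    define k where "k = max m (Suc i)"
    have "branch (y x) k \<notin> range (branch z)"
    proof
      assume "branch (y x) k \<in> range (branch z)"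
      then obtain j where eq: "branch (y x) k = branch z j"
        by blast
      have "length (branch (y x) k) = length (branch z j)"
        by (simp only: eq)
      then have "k = j"
        by simp
      with eq have "branch (y x) k = branch z k"
        by simp
      then have "branch (y x) k ! i = branch z k ! i"
        by (simp only:)
      moreover have "i < k"
        by (simp add: k_def)
      ultimately show False
        using i by simp
    qed
    moreover have "prefix (branch z m) (branch (y x) k)"
      using prefix_branch_iff[of "y x" m k] x(2) by (simp add: k_def)
    moreover have "branch (y x) k \<in> B"
      unfolding B_def using x(1) by blast
    ultimately show ?thesis
      by blast
  qed
  then obtain a :: "nat \<Rightarrow> word" where a: "\<And>n. a n \<in> B" "inj a" "antichain (range a)"
    using comb_antichain[of "\<lambda>_. B" z] by blast
  have "infinite (range (\<lambda>n. u @ a n))"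
    using a(2) by (intro range_inj_infinite) (simp add: inj_def)
  moreover have "antichain (range (\<lambda>n. u @ a n))"
    using a(3) unfolding antichain_def pairwise_def parallel_def by fastforce
  moreover have "range (\<lambda>n. u @ a n) \<subseteq> E"
  proof
    fix w assume "w \<in> range (\<lambda>n. u @ a n)"
    then obtain n where n: "w = u @ a n"
      by blast
    obtain x k where "a n = branch (y x) k" "x \<in> T"
      using a(1)[of n] unfolding B_def by blast
    then show "w \<in> E"
      using E n by simp
  qed
  ultimately show ?thesis
    unfolding antichain_ideal_def by blast
qed

lemma uncountable_nat_sets: "uncountable (UNIV :: nat set set)"
proof
  assume "countable (UNIV :: nat set set)"
  then have "countable (UNIV :: real set)"
    by (rule countable_lepoll) (rule eqpoll_imp_lepoll[OF eqpoll_sym[OF nat_sets_eqpoll_reals]])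
  with uncountable_UNIV_real show False ..
qed

lemma OCA_not_ring_iso:
  assumes OCA
  shows "\<not> R1 \<simeq> R2"
proof
  assume "R1 \<simeq> R2"
  note I = set_ideal_antichain_ideal
  obtain R where R: "bool_corr Fin antichain_ideal R" "Domain R = UNIV" "Range R = UNIV"
    using bool_corr_of_ring_iso[OF set_ideal_Fin I] \<open>R1 \<simeq> R2\<close> unfolding R1_def R2_def by blast
  have fin_iff: "finite c \<longleftrightarrow> C \<in> antichain_ideal" if "(c, C) \<in> R" for c C
    using bool_corr_ideal[OF R(1) that] by (simp add: Fin_def)
  have pre: "\<exists>c. (c, C) \<in> R" for C
    using R(3) by (metis RangeE UNIV_I)
  obtain W :: "nat set set" and r where W: "omega1_order W r"
    by (rule omega1_order_exists[OF uncountable_nat_sets])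
  \<comment> \<open>The characteristic function of \<open>A\<close> read as a branch, so that
    distinct sets index distinct branches.\<close>
  define y where "y A n = (if n \<in> A then Left else Right)" for A :: "nat set" and n
  have inj_y: "inj y"
    by (rule injI) (auto simp: y_def fun_eq_iff set_eq_iff split: if_splits)
  define K where "K n = {w. prefix (comb_tooth n) w}" for n
  define C where "C A = {comb_tooth n @ branch (y A) k | n k. True}" for A
  define F where "F X = (SOME x. (x, X) \<in> R)" for X
  have F: "(F X, X) \<in> R" for X
    unfolding F_def by (rule someI_ex[OF pre])
  define a where "a n = F (K n)" for n
  have a: "(a n, K n) \<in> R" for n
    unfolding a_def by (rule F)
  define c where "c A = F (C A)" for A
  have c: "(c A, C A) \<in> R" for A
    unfolding c_def by (rule F)
  have K_par: "v \<parallel> w" if "v \<in> K m" "w \<in> K n" "m \<noteq> n" for v w m n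
    using that comb_tooth_parallel by (simp add: K_def)
  have CK: "C A \<inter> K n = {comb_tooth n @ branch (y A) k | k. True}" for A n
  proof
    show "C A \<inter> K n \<subseteq> {comb_tooth n @ branch (y A) k | k. True}"
    proof
      fix w assume w: "w \<in> C A \<inter> K n"
      then obtain m k where mk: "w = comb_tooth m @ branch (y A) k"
        by (auto simp: C_def)
      then have "w \<in> K m"
        by (simp add: K_def del: append_assoc)
      then have "m = n"
        using K_par[of w m w n] w by (auto simp: parallel_def)
      with mk show "w \<in> {comb_tooth n @ branch (y A) k | k. True}"
        by blast
    qed
    show "{comb_tooth n @ branch (y A) k | k. True} \<subseteq> C A \<inter> K n"
      by (auto simp: C_def K_def)
  qed
  have "C A \<inter> K n \<in> antichain_ideal" for A n
    unfolding CK by (rule chain_in_antichain_ideal) (auto simp: prefix_branch_iff)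
  then have "finite (c A \<inter> a n)" for A n
    using fin_iff[OF bool_corr_Int[OF R(1) c a]] by blast
  \<comment> \<open>The bounds of these finite sets form the function \<open>g A\<close> to which
    the bounding principle is applied.\<close>
  then have "\<exists>b. c A \<inter> a n \<subseteq> {..<b}" for A n
    by (simp add: finite_nat_iff_bounded)
  then obtain g where g: "\<And>A n. c A \<inter> a n \<subseteq> {..<g A n}"
    by metis
  obtain Y f where Y: "Y \<subseteq> W" "uncountable Y" "\<And>A. A \<in> Y \<Longrightarrow> \<forall>\<^sub>F n in sequentially. g A n \<le> f n"
    by (rule OCA_bounded[OF \<open>OCA\<close> W, of g]) (blast intro: that)
  \<comment> \<open>The largest set that meets each \<open>a n\<close> only below
    \<open>f n\<close>.\<close>
  define d where "d = {k. \<forall>n. k \<in> a n \<longrightarrow> k < f n}"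
  obtain D where D: "(d, D) \<in> R"
    using R(2) by (metis DomainE UNIV_I)
  have DK: "D \<inter> K n \<in> antichain_ideal" for n
  proof -
    have "d \<inter> a n \<subseteq> {..<f n}"
      by (auto simp: d_def)
    then have "finite (d \<inter> a n)"
      by (rule finite_subset) simp
    then show ?thesis
      using fin_iff[OF bool_corr_Int[OF R(1) D a]] by blast
  qed
  \<comment> \<open>If \<open>D\<close> missed a word of every copy, these words would form an
    infinite antichain in \<open>C A - D\<close>. But \<open>c A - d\<close> is finite: its elements
    lie below \<open>g A n\<close> and not below \<open>f n\<close> for some \<open>n\<close>, which
    is possible for finitely many \<open>n\<close> only.\<close>
  have "\<exists>n. C A \<inter> K n \<subseteq> D" if A: "A \<in> Y" for A
  proof (rule ccontr)
    assume "\<not> ?thesis"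
    then have "\<forall>n. \<exists>w. w \<in> C A \<inter> K n - D"
      by blast
    then obtain p where p: "\<And>n. p n \<in> C A \<inter> K n - D"
      by metis
    have par: "p m \<parallel> p n" if "m \<noteq> n" for m n
      using K_par[of "p m" m "p n" n] p[of m] p[of n] that by blast
    then have "inj p"
      unfolding inj_def by (metis parallel_def prefix_order.order_refl)
    moreover have "antichain (range p)"
      unfolding antichain_def
    proof (rule pairwiseI)
      fix v w assume "v \<in> range p" "w \<in> range p" "v \<noteq> w"
      then obtain m n where "v = p m" "w = p n" "m \<noteq> n"
        by blast
      then show "v \<parallel> w"
        using par by simp
    qed
    moreover have "range p \<subseteq> C A - D"
      using p by blast
    ultimately have "C A - D \<notin> antichain_ideal"
      unfolding antichain_ideal_def using range_inj_infinite by blast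
    moreover have "finite (c A - d)"
    proof -
      obtain n0 where n0: "\<And>n. n0 \<le> n \<Longrightarrow> g A n \<le> f n"
        using Y(3)[OF A] by (auto simp: eventually_sequentially)
      have "c A - d \<subseteq> (\<Union>n<n0. {..<g A n})"
      proof
        fix k assume k: "k \<in> c A - d"
        then obtain n where n: "k \<in> a n" "f n \<le> k"
          by (auto simp: d_def)
        then have "k < g A n"
          using g[of A n] k by blast
        moreover from this have "n < n0"
          using n(2) n0[of n] by (meson leD le_trans not_le)
        ultimately show "k \<in> (\<Union>n<n0. {..<g A n})"
          by blast
      qed
      then show ?thesis
        by (rule finite_subset) simp
    qed
    ultimately show False
      using fin_iff[OF bool_corr_Diff[OF R(1) c D]] by blast
  qed
  then obtain N where N: "\<And>A. A \<in> Y \<Longrightarrow> C A \<inter> K (N A) \<subseteq> D"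
    by metis
  \<comment> \<open>There are only countably many indices, so for one fixed \<open>n\<close>
    uncountably many branches have their \<open>n\<close>-th copy inside \<open>D\<close>.\<close>
  obtain n where n: "uncountable {A \<in> Y. N A = n}"
    by (rule uncountable_pigeonhole[OF Y(2), of N]) auto
  have "D \<inter> K n \<notin> antichain_ideal"
  proof (rule infinitely_many_branches)
    show "infinite {A \<in> Y. N A = n}"
      using n countable_finite by blast
    show "inj_on y {A \<in> Y. N A = n}"
      using inj_y by (rule inj_on_subset) simp
    fix A k assume A: "A \<in> {A \<in> Y. N A = n}"
    then have "C A \<inter> K n \<subseteq> D"
      using N by auto
    moreover have "comb_tooth n @ branch (y A) k \<in> C A \<inter> K n"
      unfolding CK by blast
    ultimately show "comb_tooth n @ branch (y A) k \<in> D \<inter> K n"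
      by blast
  qed
  with DK show False
    by blast
qed

section \<open>The isomorphism under CH and the conclusion\<close>

lemma countable_UNIV_word: "countable (UNIV :: word set)"
proof -
  have "UNIV = {Left, Right}"
    using letter.exhaust by blast
  then have "countable (UNIV :: letter set)"
    by (metis countable_finite finite.simps)
  then show ?thesis
    using countable_lists by (metis lists_UNIV)
qed

lemma CH_R1_iso_R2:
  assumes CH
  shows "R1 \<simeq> R2"
  unfolding R1_def R2_def
  by (rule CH_ring_iso[OF \<open>CH\<close> saturated_Fin saturated_antichain_ideal])
    (simp_all add: countable_UNIV_word infinite_UNIV_listI)

theorem theorem6p3:
  shows "(CH \<longrightarrow> R1 \<simeq> R2) \<and> (OCA \<longrightarrow> \<not> R1 \<simeq> R2)"
  using CH_R1_iso_R2 OCA_not_ring_iso by blast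

end
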